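(* Let $V$ be a simple Euclidean Jordan algebra with associated symmetric cone $\Omega$, let $g\in G(\Omega)$ and let $p\in\mathbb{R}$ be such that $|p|>1$. Then there exists a unique element $a\in\Omega$ such that $g(a)=a^p$.
   Context: A Euclidean Jordan algebra is a finite-dimensional real inner product space $(V,(\cdot|\cdot))$ with a bilinear product satisfying $xy=yx$, $x(x^2y)=x^2(xy)$ and $(xy|z)=(y|xz)$; it has an identity element $e$. It is simple if it has no non-trivial ideal. Its symmetric cone $\Omega$ is the interior of the set of squares $\{x^2 : x\in V\}$. The group $G(\Omega)$ is $\{g\in GL(V) : g(\Omega)=\Omega\}$. A Jordan frame is a complete system $\{c_1,\dots,c_r\}$ of non-zero orthogonal primitive idempotents: $c_i^2=c_i$, each $c_i$ is indecomposable (not a sum of two non-zero orthogonal idempotents), $c_ic_j=0$ for $i\neq j$, and $c_1+\dots+c_r=e$, where $r$ is the rank of $V$. Every $x\in V$ can be written $x=\sum_{j=1}^r\lambda_jc_j$ for some Jordan frame and real numbers $\lambda_j$ (the eigenvalues of $x$, determined by $x$ with multiplicity); $x\in\Omega$ if and only if all $\lambda_j>0$. For $x=\sum_{j=1}^r\lambda_jc_j\in\Omega$ and $p\in\mathbb{R}$, $x^p:=\sum_{j=1}^r\lambda_j^pc_j$. *)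

theory Defs
  imports "HOL-Analysis.Analysis"
begin

text \<open>
  The underlying inner product space is a type of class \<open>euclidean_space\<close>; the inner product
  is the one of that class.  Such a type is never the zero space.
\<close>

locale euclidean_jordan_algebra =
  fixes jmult :: "'a::euclidean_space \<Rightarrow> 'a \<Rightarrow> 'a"  (infixl \<open>\<odot>\<close> 70)
    and e :: 'a
  assumes bilinear_jmult: "bilinear (\<odot>)"
    and jmult_commute: "x \<odot> y = y \<odot> x"
    and jordan_identity: "x \<odot> ((x \<odot> x) \<odot> y) = (x \<odot> x) \<odot> (x \<odot> y)"
    and inner_jmult: "inner (x \<odot> y) z = inner y (x \<odot> z)"
    and jmult_identity: "e \<odot> x = x"
begin

definition jordan_ideal :: "'a set \<Rightarrow> bool"
  where "jordan_ideal I \<longleftrightarrow> subspace I \<and> (\<forall>x\<in>I. \<forall>y. y \<odot> x \<in> I)"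

definition symmetric_cone :: "'a set"
  where "symmetric_cone = interior {x \<odot> x |x. True}"

definition cone_group :: "('a \<Rightarrow> 'a) set"
  where "cone_group = {g. linear g \<and> bij g \<and> g ` symmetric_cone = symmetric_cone}"

definition idempotent :: "'a \<Rightarrow> bool"
  where "idempotent c \<longleftrightarrow> c \<odot> c = c"

definition primitive_idempotent :: "'a \<Rightarrow> bool"
  where "primitive_idempotent c \<longleftrightarrow> idempotent c \<and> c \<noteq> 0 \<and>
    \<not> (\<exists>u v. idempotent u \<and> idempotent v \<and> u \<noteq> 0 \<and> v \<noteq> 0 \<and> u \<odot> v = 0 \<and> c = u + v)"

definition jordan_frame :: "'a set \<Rightarrow> bool"
  where "jordan_frame C \<longleftrightarrow> finite C \<and> (\<forall>c\<in>C. primitive_idempotent c) \<and>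
    (\<forall>c\<in>C. \<forall>d\<in>C. c \<noteq> d \<longrightarrow> c \<odot> d = 0) \<and> (\<Sum>c\<in>C. c) = e"

text \<open>
  Meaningful for \<open>x\<close> in the symmetric cone, where all eigenvalues \<open>l c\<close> are positive.  The
  description is legitimate because the value does not depend on the chosen spectral
  decomposition of \<open>x\<close>.
\<close>

definition jordan_power :: "'a \<Rightarrow> real \<Rightarrow> 'a"
  where "jordan_power x p = (THE y. \<exists>C l. jordan_frame C \<and>
    x = (\<Sum>c\<in>C. l c *\<^sub>R c) \<and> y = (\<Sum>c\<in>C. (l c powr p) *\<^sub>R c))"

end

locale simple_euclidean_jordan_algebra = euclidean_jordan_algebra +
  assumes simple: "jordan_ideal I \<Longrightarrow> I = {0} \<or> I = UNIV"

end

theory Submission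
  imports Defs
begin

text \<open>
  For \<open>a\<close> in the symmetric cone, \<open>g a = a\<^sup>p\<close> means that \<open>a\<close> is a fixed point of
  \<open>F a = (g a)\<^sup>q\<close> with \<open>q = 1 / p\<close>.  The linear map \<open>g\<close> is an isometry of the Thompson metric, and the
  power map with exponent \<open>q\<close> contracts this metric by the factor \<open>\<bar>q\<bar> < 1\<close>, because inversion
  is antitone and powers with exponents in \<open>(0, 1)\<close> are monotone for the order of the cone.  The
  metric is complete, so the iterates of \<open>F\<close> converge to the only fixed point.

  Monotonicity rests on a Lyapunov argument: if \<open>a\<close> is in the open cone and \<open>a \<odot> z \<ge> 0\<close>, then
  \<open>z \<ge> 0\<close>.  By a limit of products of such inverse multiplications, the inverse of the quadratic
  representation preserves the cone; its negative is the derivative of inversion.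
\<close>

section \<open>Self-adjoint maps\<close>

text \<open>The obstacle is positivity of the quadratic representation P(x), usually drawn from the
  fundamental formula. Here P(x) is never defined. Its inverse applied to \<open>h\<close> enters
  only as the solution \<open>w\<close> of
  \<open>x \<odot> w = spectral_fun inverse x \<odot> h\<close>, which is the equation that
  differentiating "\<open>y\<close> times its inverse is \<open>e\<close>" produces. Multiplication
  by \<open>x\<close> and P(x) act on the Peirce component (i, j) as the scalars
  \<open>(l i + l j) / 2\<close> and \<open>l i * l j\<close>, so the limit formula for
  \<open>exp\<close> turns the arithmetic mean of logarithms into a product of eigenvalues.
  Positivity is always tested by pairing with idempotents: this condition passes to sums and limits
  at once, and it lets the mean value theorem and the integral be used for real functions only. It
  rests on the cubic equation satisfied by multiplication by an idempotent. The exponent is 1 / p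
  because |p| > 1 makes the inverse power the contracting one: a monotone map that is homogeneous of
  degree q turns the factor \<open>exp r\<close> in an order bound into \<open>exp (q * r)\<close>.
  The Thompson distance is kept as a relation with parameter \<open>r\<close>, so order bounds
  survive limits simply because the cone is closed.\<close>

lemma selfadjoint_has_eigenvector:
  fixes T :: "'a::euclidean_space \<Rightarrow> 'a"
  assumes "linear T" and S: "subspace S" and inv: "\<And>x. x \<in> S \<Longrightarrow> T x \<in> S"
    and sa: "\<And>x y. T x \<bullet> y = x \<bullet> T y" and ne: "\<not> S \<subseteq> {0}"
  obtains v k where "v \<in> S" "v \<noteq> 0" "T v = k *\<^sub>R v"
proof -
  interpret T: linear T by fact
  obtain u where u: "u \<in> S" "u \<noteq> 0" using ne by blast
  let ?U = "S \<inter> sphere 0 1"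
  have "compact ?U"
    using closed_Int_compact[OF closed_subspace[OF S] compact_sphere] .
  moreover have "(1 / norm u) *\<^sub>R u \<in> ?U"
    using u S by (auto intro: subspace_scale)
  moreover have "continuous_on ?U (\<lambda>v. T v \<bullet> v)"
    by (intro continuous_intros linear_continuous_on linear_conv_bounded_linear[THEN iffD1] assms)
  ultimately obtain v where v: "v \<in> ?U" and max: "\<And>w. w \<in> ?U \<Longrightarrow> T w \<bullet> w \<le> T v \<bullet> v"
    using continuous_attains_sup[of ?U "\<lambda>v. T v \<bullet> v"] by blast
  define M where "M = T v \<bullet> v"
  have vv: "v \<bullet> v = 1" using v by (simp add: dot_square_norm)
  define q where "q w = M * (w \<bullet> w) - T w \<bullet> w" for w
  have q: "0 \<le> q w" if "w \<in> S" for w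
  proof (cases "w = 0")
    case False
    have "(1 / norm w) *\<^sub>R w \<in> ?U" using False that S by (auto intro: subspace_scale)
    from max[OF this] have "(T w \<bullet> w) / (norm w)\<^sup>2 \<le> M"
      by (simp add: M_def T.scale power2_eq_square)
    then show ?thesis using False by (simp add: q_def field_simps dot_square_norm)
  qed (simp add: q_def)
  \<comment> \<open>Here \<open>q\<close> is nonnegative on \<open>S\<close> and vanishes at the
    maximiser \<open>v\<close>. Moving from \<open>v\<close> along the residual \<open>r\<close>
    changes \<open>q\<close> to first order by \<open>- 2 * s * (r \<bullet> r)\<close>, which
    forces \<open>r = 0\<close>.\<close>
  define r where "r = T v - M *\<^sub>R v"
  have r: "r \<in> S" unfolding r_def using v inv S by (auto intro: subspace_diff subspace_scale)
  have "r = 0"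
  proof (rule ccontr)
    assume "r \<noteq> 0"
    then have rr: "r \<bullet> r > 0" by simp
    \<comment> \<open>Small enough that the quadratic term in \<open>s\<close> cannot outweigh the
      linear one; the \<open>+ 1\<close> covers the case \<open>q r = 0\<close>.\<close>
    define s where "s = (r \<bullet> r) / (q r + 1)"
    have s: "s > 0" using q[OF r] rr by (simp add: s_def)
    have "s * q r < r \<bullet> r"
      using q[OF r] rr by (simp add: s_def field_simps)
    have "v + s *\<^sub>R r \<in> S" using v r S by (auto intro: subspace_add subspace_scale)
    from q[OF this] have "0 \<le> q (v + s *\<^sub>R r)" .
    also have "q (v + s *\<^sub>R r) = q v + s * (s * q r) - 2 * s * (T v \<bullet> r - M * (v \<bullet> r))"
      using sa[of r v] sa[of v r]
      by (simp add: q_def T.add T.scale inner_simps inner_commute algebra_simps)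
    also have "T v \<bullet> r - M * (v \<bullet> r) = r \<bullet> r"
      by (simp add: r_def inner_diff_left[of "T v"])
    also have "q v = 0" by (simp add: q_def M_def vv)
    finally have "s * (2 * (r \<bullet> r) - s * q r) \<le> 0" by (simp add: algebra_simps)
    then show False using s \<open>s * q r < r \<bullet> r\<close> rr by (simp add: mult_le_0_iff)
  qed
  then have "T v = M *\<^sub>R v" by (simp add: r_def)
  moreover have "v \<noteq> 0" using vv by auto
  ultimately show ?thesis using that v by blast
qed

lemma card_le_DIM_orthogonal:
  fixes B :: "'a::euclidean_space set"
  assumes "pairwise orthogonal B" "0 \<notin> B"
  shows "card B \<le> DIM('a)"
  using pairwise_orthogonal_independent[OF assms] independent_bound by blast

text \<open>A largest orthogonal family of eigenvectors in \<open>S\<close> spans \<open>S\<close>: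
  its orthogonal complement inside \<open>S\<close> is invariant by self-adjointness and would
  otherwise supply one more eigenvector. A general invariant \<open>S\<close> is allowed because the
  spectral theorem takes the span of the powers of one element.\<close>

lemma selfadjoint_eigenbasis:
  fixes T :: "'a::euclidean_space \<Rightarrow> 'a"
  assumes T: "linear T" and S: "subspace S" and inv: "\<And>x. x \<in> S \<Longrightarrow> T x \<in> S"
    and sa: "\<And>x y. T x \<bullet> y = x \<bullet> T y"
  obtains B where "finite B" "B \<subseteq> S" "pairwise orthogonal B" "0 \<notin> B" "span B = S"
    "\<forall>v\<in>B. \<exists>k. T v = k *\<^sub>R v"
proof -
  define P where "P B \<longleftrightarrow> finite B \<and> B \<subseteq> S \<and> pairwise orthogonal B \<and> 0 \<notin> B \<and>
    (\<forall>v\<in>B. \<exists>k. T v = k *\<^sub>R v)" for B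
  have "P {}" by (simp add: P_def)
  moreover have "\<forall>B. P B \<longrightarrow> card B < Suc DIM('a)"
    using card_le_DIM_orthogonal by (auto simp: P_def less_Suc_eq_le)
  ultimately obtain B where B: "P B" and max: "\<And>B'. P B' \<Longrightarrow> card B' \<le> card B"
    using ex_has_greatest_nat[of P "{}" card "Suc DIM('a)"] by (metis less_imp_le)
  have "S \<subseteq> span B"
  proof (rule ccontr)
    assume "\<not> S \<subseteq> span B"
    then obtain x where x: "x \<in> S" "x \<notin> span B" by blast
    define S' where "S' = {x\<in>S. \<forall>b\<in>B. x \<bullet> b = 0}"
    obtain y z where yz: "y \<in> span B" "\<And>w. w \<in> span B \<Longrightarrow> orthogonal z w" "x = y + z"
      using orthogonal_subspace_decomp_exists[of B x] by metis
    have "y \<in> S" using yz(1) B S span_minimal[of B S] by (auto simp: P_def)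
    then have "z \<in> S" using x yz(3) S by (metis add_diff_cancel_left' subspace_diff)
    then have "z \<in> S'" using yz(2) span_base by (force simp: S'_def orthogonal_def)
    moreover have "z \<noteq> 0" using x yz by auto
    ultimately have ne: "\<not> S' \<subseteq> {0}" by blast
    have S': "subspace S'"
      using S by (auto simp: subspace_def S'_def inner_simps)
    have inv': "T x \<in> S'" if "x \<in> S'" for x
    proof -
      have "T x \<bullet> b = 0" if b: "b \<in> B" for b
      proof -
        obtain k where "T b = k *\<^sub>R b" using B b by (auto simp: P_def)
        then show ?thesis using \<open>x \<in> S'\<close> b sa[of x b] by (simp add: S'_def)
      qed
      then show ?thesis using that inv by (simp add: S'_def)
    qed
    obtain v k where v: "v \<in> S'" "v \<noteq> 0" "T v = k *\<^sub>R v"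
      using selfadjoint_has_eigenvector[OF T S' inv' sa ne] .
    have "v \<notin> B" using v by (auto simp: S'_def)
    moreover have "P (insert v B)"
      using B v by (auto simp: P_def S'_def pairwise_insert orthogonal_def inner_commute)
    ultimately show False using max[of "insert v B"] B by (auto simp: P_def)
  qed
  moreover have "span B \<subseteq> S" using B S span_minimal by (auto simp: P_def)
  ultimately show ?thesis using B that by (auto simp: P_def)
qed

section \<open>An integral representation of powers\<close>

lemma integrable_exp_minus_atLeast_0:
  fixes k :: real
  assumes "0 < k"
  shows "integrable lborel (\<lambda>v. exp (- k * v) * indicator {0..} v :: real)"
proof (rule integrableI_nonneg)
  have "((\<lambda>v. - (exp (- k * v) / k)) \<longlongrightarrow> - (0 / k)) at_top"
    using assms
    by (intro tendsto_intros filterlim_compose[OF exp_at_bot] filterlim_tendsto_neg_mult_at_bot[OF tendsto_const] filterlim_ident) auto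
  then have "(\<integral>\<^sup>+v. ennreal (exp (- k * v)) * indicator {0..} v \<partial>lborel) = - (0 / k) - - (exp (- k * 0) / k)"
    using assms
    by (intro nn_integral_FTC_atLeast) (auto intro!: derivative_eq_intros)
  moreover have "ennreal (exp (- k * v)) * indicator {0..} v = ennreal (exp (- k * v) * indicator {0..} v)" for v
    by (simp split: split_indicator)
  ultimately show "(\<integral>\<^sup>+v. ennreal (exp (- k * v) * indicator {0..} v) \<partial>lborel) < \<infinity>"
    by simp
qed auto

text \<open>The substitution u = exp v in the classical integral of u^(t-1) s / (s + u) over the
  positive half-line. Up to the factor \<open>s powr t\<close> the integrand is the translate of one
  function \<open>f\<close> by \<open>ln s\<close>, so its integral is the same constant
  \<open>K\<close> for every \<open>s\<close>. Writing s / (s + u) as 1 - u / (s + u) leaves an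
  inverse as the only function of \<open>s\<close>.\<close>

lemma powr_integral_representation:
  fixes t :: real
  assumes "0 < t" "t < 1"
  obtains K where "0 < K"
    "\<forall>s>0. has_bochner_integral lborel (\<lambda>v. exp (t * v) * (1 - exp v * inverse (s + exp v))) (s powr t * K)"
proof -
  define f where "f v = exp (t * v) / (1 + exp v)" for v :: real
  have meas [measurable]: "f \<in> borel_measurable lborel" unfolding f_def by measurable
  have pos: "0 < f v" for v by (simp add: f_def add_pos_pos)
  \<comment> \<open>\<open>f\<close> decays like exp (-(1-t) v) to the right, by t < 1, and like exp
    (t v) to the left, by t > 0.\<close>
  have g1: "integrable lborel (\<lambda>v. exp (- (1 - t) * v) * indicator {0..} v :: real)"
    using assms by (intro integrable_exp_minus_atLeast_0) simp
  have "integrable lborel (\<lambda>v. exp (- t * (0 + (-1) * v)) * indicator {0..} (0 + (-1) * v) :: real)"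
    using lborel_integrable_real_affine[OF integrable_exp_minus_atLeast_0[OF assms(1)], of "-1" 0] by simp
  then have g2: "integrable lborel (\<lambda>v. exp (t * v) * indicator {0..} (- v) :: real)" by simp
  have int: "integrable lborel f"
  proof (rule Bochner_Integration.integrable_bound[OF Bochner_Integration.integrable_add[OF g1 g2] meas], rule AE_I2)
    fix v :: real
    have "f v \<le> exp (- (1 - t) * v) * indicator {0..} v + exp (t * v) * indicator {0..} (- v)"
    proof (cases "0 \<le> v")
      case True
      have "f v \<le> exp (t * v) / exp v" unfolding f_def by (intro divide_left_mono) (auto simp: add_pos_pos)
      also have "\<dots> = exp (t * v - v)" by (simp only: exp_diff)
      also have "t * v - v = - (1 - t) * v" by (simp add: algebra_simps)
      finally have "f v \<le> exp (- (1 - t) * v) * indicator {0..} v" using True by simp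
      moreover have "0 \<le> exp (t * v) * indicator {0..} (- v)" by simp
      ultimately show ?thesis by linarith
    next
      case False
      have "f v \<le> exp (t * v) / 1" unfolding f_def by (intro divide_left_mono) (auto simp: add_pos_pos)
      then show ?thesis using False by simp
    qed
    then show "norm (f v) \<le> norm (exp (- (1 - t) * v) * indicator {0..} v + exp (t * v) * indicator {0..} (- v))"
      using pos[of v] by simp
  qed
  define K where "K = integral\<^sup>L lborel f"
  have "0 \<le> K" unfolding K_def using pos by (intro Bochner_Integration.integral_nonneg) (simp add: less_imp_le)
  moreover have "K \<noteq> 0"
  proof
    assume "K = 0"
    then have "AE v in lborel. f v = 0"
      unfolding K_def using integral_nonneg_eq_0_iff_AE[OF int] pos by (simp add: less_imp_le)
    then have "AE v in (lborel :: real measure). False"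
      by (rule eventually_mono) (use pos in \<open>simp add: less_imp_neq[symmetric]\<close>)
    then have "ae_filter (lborel :: real measure) = bot" by (simp only: trivial_limit_def)
    then show False by (simp add: ae_filter_eq_bot_iff)
  qed
  ultimately have "0 < K" by simp
  moreover have "\<forall>s>0. has_bochner_integral lborel (\<lambda>v. exp (t * v) * (1 - exp v * inverse (s + exp v))) (s powr t * K)"
  proof (intro allI impI)
    fix s :: real assume s: "0 < s"
    have eq: "exp (t * v) * (1 - exp v * inverse (s + exp v)) = s powr t * f (- ln s + 1 * v)" for v
    proof -
      have "exp (- ln s + 1 * v) = exp v / s" using s by (simp add: exp_diff)
      then have "s powr t * f (- ln s + 1 * v) = s powr t * exp (t * (- ln s + 1 * v)) / (1 + exp v / s)"
        by (simp only: f_def times_divide_eq_right)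
      also have "s powr t * exp (t * (- ln s + 1 * v)) = exp (t * ln s + t * (- ln s + 1 * v))"
        using s by (simp add: powr_def exp_add)
      also have "t * ln s + t * (- ln s + 1 * v) = t * v" by (simp add: algebra_simps)
      also have "exp (t * v) / (1 + exp v / s) = exp (t * v) * (1 / (1 + exp v / s))" by simp
      finally have eq: "s powr t * f (- ln s + 1 * v) = exp (t * v) * (1 / (1 + exp v / s))" .
      have "1 / (1 + u / s) = 1 - u * inverse (s + u)" if "0 < u" for u
      proof -
        have "1 + u / s = (s + u) / s" using s by (simp add: add_divide_distrib)
        moreover have "1 - u * inverse (s + u) = s / (s + u)"
          using s that by (simp add: divide_inverse[symmetric] diff_divide_eq_iff)
        ultimately show ?thesis by simp
      qed
      from this[of "exp v"] show ?thesis unfolding eq by simp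
    qed
    have "integrable lborel (\<lambda>v. f (- ln s + 1 * v))"
      by (rule lborel_integrable_real_affine[OF int]) simp
    moreover have "integral\<^sup>L lborel (\<lambda>v. f (- ln s + 1 * v)) = K"
      unfolding K_def using lborel_integral_real_affine[of 1 f "- ln s"] by simp
    ultimately have "has_bochner_integral lborel (\<lambda>v. f (- ln s + 1 * v)) K"
      by (simp add: has_bochner_integral_iff)
    then show "has_bochner_integral lborel (\<lambda>v. exp (t * v) * (1 - exp v * inverse (s + exp v))) (s powr t * K)"
      unfolding eq by (rule has_bochner_integral_mult_right)
  qed
  ultimately show ?thesis by (rule that)
qed

context euclidean_jordan_algebra
begin

section \<open>Consequences of the Jordan identity\<close>

lemmas jmult_add_left = bilinear_ladd[OF bilinear_jmult]
  and jmult_add_right = bilinear_radd[OF bilinear_jmult]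
  and jmult_scale_left = bilinear_lmul[OF bilinear_jmult]
  and jmult_scale_right = bilinear_rmul[OF bilinear_jmult]
  and jmult_zero_left = bilinear_lzero[OF bilinear_jmult]
  and jmult_zero_right = bilinear_rzero[OF bilinear_jmult]
  and jmult_diff_left = bilinear_lsub[OF bilinear_jmult]
  and jmult_diff_right = bilinear_rsub[OF bilinear_jmult]
  and jmult_minus_left = bilinear_lneg[OF bilinear_jmult]
  and jmult_minus_right = bilinear_rneg[OF bilinear_jmult]

lemmas jmult_simps = jmult_add_left jmult_add_right jmult_scale_left jmult_scale_right
  jmult_zero_left jmult_zero_right jmult_diff_left jmult_diff_right
  jmult_minus_left jmult_minus_right

lemma jmult_identity_right: "x \<odot> e = x"
  using jmult_commute jmult_identity by metis

lemma linear_jmult: "linear ((\<odot>) x)"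
  by (rule linearI) (simp_all add: jmult_simps)

lemma bounded_bilinear_jmult: "bounded_bilinear (\<odot>)"
  using bilinear_jmult bilinear_conv_bounded_bilinear by blast

lemma jmult_sum_right: "x \<odot> sum f A = (\<Sum>i\<in>A. x \<odot> f i)"
  using linear_sum[OF linear_jmult] .

lemma jmult_sum_left: "sum f A \<odot> x = (\<Sum>i\<in>A. f i \<odot> x)"
  by (subst (1 2) jmult_commute) (rule jmult_sum_right)

text \<open>Polarisation: the Jordan identity at x + z and at x - z is sorted by degree in
  \<open>z\<close>. Degrees 0 and 3 vanish by the identity itself, and the change of sign separates
  degree 1 (\<open>F\<close>) from degree 2 (\<open>G\<close>).\<close>

lemma jordan_identity_linearized:
  "z \<odot> ((x \<odot> x) \<odot> y) + 2 *\<^sub>R (x \<odot> ((x \<odot> z) \<odot> y)) = 2 *\<^sub>R ((x \<odot> z) \<odot> (x \<odot> y)) + (x \<odot> x) \<odot> (z \<odot> y)"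
proof -
  have zx: "z \<odot> x = x \<odot> z" by (rule jmult_commute)
  have p: "(x \<odot> ((x \<odot> x) \<odot> y) - (x \<odot> x) \<odot> (x \<odot> y))
      + (z \<odot> ((z \<odot> z) \<odot> y) - (z \<odot> z) \<odot> (z \<odot> y))
      + (z \<odot> ((x \<odot> x) \<odot> y) + 2 *\<^sub>R (x \<odot> ((x \<odot> z) \<odot> y)) - 2 *\<^sub>R ((x \<odot> z) \<odot> (x \<odot> y)) - (x \<odot> x) \<odot> (z \<odot> y))
      + (x \<odot> ((z \<odot> z) \<odot> y) + 2 *\<^sub>R (z \<odot> ((x \<odot> z) \<odot> y)) - 2 *\<^sub>R ((x \<odot> z) \<odot> (z \<odot> y)) - (z \<odot> z) \<odot> (x \<odot> y)) = 0"
    using jordan_identity[of "x + z" y]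
    by (simp add: jmult_simps zx scaleR_2 algebra_simps)
  have m: "(x \<odot> ((x \<odot> x) \<odot> y) - (x \<odot> x) \<odot> (x \<odot> y))
      - (z \<odot> ((z \<odot> z) \<odot> y) - (z \<odot> z) \<odot> (z \<odot> y))
      - (z \<odot> ((x \<odot> x) \<odot> y) + 2 *\<^sub>R (x \<odot> ((x \<odot> z) \<odot> y)) - 2 *\<^sub>R ((x \<odot> z) \<odot> (x \<odot> y)) - (x \<odot> x) \<odot> (z \<odot> y))
      + (x \<odot> ((z \<odot> z) \<odot> y) + 2 *\<^sub>R (z \<odot> ((x \<odot> z) \<odot> y)) - 2 *\<^sub>R ((x \<odot> z) \<odot> (z \<odot> y)) - (z \<odot> z) \<odot> (x \<odot> y)) = 0"
    using jordan_identity[of "x - z" y]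
    by (simp add: jmult_simps zx scaleR_2 algebra_simps)
  define F where "F = z \<odot> ((x \<odot> x) \<odot> y) + 2 *\<^sub>R (x \<odot> ((x \<odot> z) \<odot> y)) - 2 *\<^sub>R ((x \<odot> z) \<odot> (x \<odot> y)) - (x \<odot> x) \<odot> (z \<odot> y)"
  define G where "G = x \<odot> ((z \<odot> z) \<odot> y) + 2 *\<^sub>R (z \<odot> ((x \<odot> z) \<odot> y)) - 2 *\<^sub>R ((x \<odot> z) \<odot> (z \<odot> y)) - (z \<odot> z) \<odot> (x \<odot> y)"
  have "F + G = 0" using p by (simp only: F_def G_def jordan_identity diff_self add_0_left)
  moreover have "0 - F + G = 0" using m by (simp only: F_def G_def jordan_identity diff_self)
  ultimately have "F + F = 0" by simp
  then have "2 *\<^sub>R F = 0" unfolding scaleR_2 .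
  then have "F = 0" by simp
  then show ?thesis by (simp add: F_def algebra_simps)
qed

text \<open>A second polarisation, of the quadratic dependence on \<open>x\<close> that is left
  after the first.\<close>

lemma jordan_identity_multilinear:
  "z \<odot> ((x \<odot> w) \<odot> y) + x \<odot> ((w \<odot> z) \<odot> y) + w \<odot> ((x \<odot> z) \<odot> y)
    = (x \<odot> z) \<odot> (w \<odot> y) + (w \<odot> z) \<odot> (x \<odot> y) + (x \<odot> w) \<odot> (z \<odot> y)"
proof -
  define E where "E v = z \<odot> ((v \<odot> v) \<odot> y) + 2 *\<^sub>R (v \<odot> ((v \<odot> z) \<odot> y))
    - 2 *\<^sub>R ((v \<odot> z) \<odot> (v \<odot> y)) - (v \<odot> v) \<odot> (z \<odot> y)" for v
  have E: "E v = 0" for v using jordan_identity_linearized[of z v y] by (simp add: E_def)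
  have "E (x + w) - E x - E w
    = 2 *\<^sub>R (z \<odot> ((x \<odot> w) \<odot> y) + x \<odot> ((w \<odot> z) \<odot> y) + w \<odot> ((x \<odot> z) \<odot> y)
        - ((x \<odot> z) \<odot> (w \<odot> y) + (w \<odot> z) \<odot> (x \<odot> y) + (x \<odot> w) \<odot> (z \<odot> y)))"
    by (simp add: E_def jmult_simps jmult_commute[of w x] scaleR_2 algebra_simps)
  then show ?thesis by (simp add: E)
qed

text \<open>The right-hand side of the multilinear identity is symmetric in all four variables; comparing
  it with the identity in which \<open>x\<close> and \<open>y\<close> are exchanged expresses multiplication by a triple
  product through multiplications by products of two factors.\<close>

lemma jmult_triple:
  "((w \<odot> z) \<odot> y) \<odot> x = (w \<odot> y) \<odot> (z \<odot> x) + (w \<odot> z) \<odot> (y \<odot> x) + (z \<odot> y) \<odot> (w \<odot> x)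
    - z \<odot> (y \<odot> (w \<odot> x)) - w \<odot> (y \<odot> (z \<odot> x))"
proof -
  have "z \<odot> (y \<odot> (w \<odot> x)) + x \<odot> ((w \<odot> z) \<odot> y) + w \<odot> (y \<odot> (z \<odot> x))
    = (z \<odot> x) \<odot> (w \<odot> y) + (w \<odot> z) \<odot> (y \<odot> x) + (w \<odot> x) \<odot> (z \<odot> y)"
    using jordan_identity_multilinear[of z x w y]
    by (simp only: jmult_commute[of x] jmult_commute[of _ y])
  then show ?thesis
    by (simp add: jmult_commute[of "(w \<odot> z) \<odot> y" x] jmult_commute[of "w \<odot> y"]
      jmult_commute[of "z \<odot> y"] algebra_simps)
qed

text \<open>The case \<open>w = z = y = c\<close> of \<open>jmult_triple\<close>. Multiplication by
  \<open>c\<close> is a root of t (2t - 1) (t - 1), so its only possible eigenvalues are 0, 1/2 and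
  1.\<close>

lemma idempotent_cubic:
  assumes "idempotent c"
  shows "2 *\<^sub>R (c \<odot> (c \<odot> (c \<odot> x))) = 3 *\<^sub>R (c \<odot> (c \<odot> x)) - c \<odot> x"
  using jmult_triple[of c c c x] assms
    scaleR_left_distrib[of 2 1 "c \<odot> (c \<odot> x)"]
  by (simp add: idempotent_def algebra_simps scaleR_2)

text \<open>As quadratic forms, L^2 \<le> L for the multiplication L by \<open>c\<close>, as the
  eigenvalues 0, 1/2, 1 suggest. The positivity and orthogonality facts on idempotents below come
  from this inequality.\<close>

lemma idempotent_inner_sq:
  assumes "idempotent c"
  shows "(c \<odot> x) \<bullet> (c \<odot> x) \<le> (c \<odot> x) \<bullet> x"
proof -
  define b d where "b = c \<odot> x" and "d = c \<odot> b"
  have cd: "2 *\<^sub>R (c \<odot> d) = 3 *\<^sub>R d - b"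
    using idempotent_cubic[OF assms, of x] by (simp add: b_def d_def)
  have dx: "d \<bullet> x = b \<bullet> b" unfolding d_def inner_jmult by (simp add: b_def)
  have "d \<bullet> b = (c \<odot> d) \<bullet> x" by (simp add: b_def inner_jmult)
  moreover have "2 * ((c \<odot> d) \<bullet> x) = 3 * (d \<bullet> x) - b \<bullet> x"
    using arg_cong[OF cd, of "\<lambda>u. u \<bullet> x"] by (simp add: inner_simps)
  ultimately have m3: "2 * (d \<bullet> b) = 3 * (b \<bullet> b) - b \<bullet> x" using dx by simp
  have "d \<bullet> d = (c \<odot> d) \<bullet> b"
    by (simp add: d_def inner_jmult)
  moreover have "2 * ((c \<odot> d) \<bullet> b) = 3 * (d \<bullet> b) - b \<bullet> b"
    using arg_cong[OF cd, of "\<lambda>u. u \<bullet> b"] by (simp add: inner_simps)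
  ultimately have m4: "2 * (d \<bullet> d) = 3 * (d \<bullet> b) - b \<bullet> b" by simp
  \<comment> \<open>After reduction by the cubic this squared norm is a quarter of
    \<open>b \<bullet> x - b \<bullet> b\<close>.\<close>
  have "0 \<le> (b - d) \<bullet> (b - d)" by simp
  also have "(b - d) \<bullet> (b - d) = b \<bullet> b - 2 * (d \<bullet> b) + d \<bullet> d"
    by (simp add: inner_simps inner_commute)
  finally show ?thesis using m3 m4 unfolding b_def[symmetric] by linarith
qed

lemma idempotent_psd:
  assumes "idempotent c"
  shows "0 \<le> (c \<odot> x) \<bullet> x"
  using idempotent_inner_sq[OF assms, of x] inner_ge_zero[of "c \<odot> x"] by linarith

lemma idempotent_inner_self:
  assumes "idempotent c"
  shows "c \<bullet> e = c \<bullet> c"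
  using assms inner_jmult[of c c e] by (simp add: idempotent_def jmult_identity_right)

text \<open>The squared norm of \<open>c \<odot> d\<close> is at most
  \<open>(c \<odot> d) \<bullet> d\<close>, which equals \<open>c \<bullet> d\<close>.\<close>

lemma idempotents_orthogonal:
  assumes "idempotent c" "idempotent d" "c \<bullet> d = 0"
  shows "c \<odot> d = 0"
proof -
  have "(c \<odot> d) \<bullet> d = c \<bullet> (d \<odot> d)" by (simp add: jmult_commute[of c] inner_jmult)
  then have "(c \<odot> d) \<bullet> (c \<odot> d) \<le> 0"
    using idempotent_inner_sq[OF assms(1), of d] assms by (simp add: idempotent_def)
  then show ?thesis by (meson inner_gt_zero_iff not_le)
qed

lemma idempotents_inner_nonneg:
  assumes "idempotent c" "idempotent d"
  shows "0 \<le> c \<bullet> d"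
proof -
  have "(c \<odot> d) \<bullet> d = c \<bullet> (d \<odot> d)" by (simp add: jmult_commute[of c] inner_jmult)
  then show ?thesis using idempotent_psd[OF assms(1), of d] assms by (simp add: idempotent_def)
qed

section \<open>The spectral theorem\<close>

primrec jpow :: "'a \<Rightarrow> nat \<Rightarrow> 'a"
  where "jpow x 0 = e" | "jpow x (Suc n) = x \<odot> jpow x n"

text \<open>By \<open>jmult_triple\<close>, multiplication by \<open>jpow x (m + 2)\<close> is a
  polynomial in the multiplications by \<open>x\<close>, \<open>x \<odot> x\<close> and two lower
  powers. The Jordan identity makes the first two commute, and the recursion meets both, so the two
  commutation statements need a joint induction.\<close>

lemma jpow_operators:
  "(\<forall>y. jpow x n \<odot> (x \<odot> y) = x \<odot> (jpow x n \<odot> y)) \<and>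
   (\<forall>y. jpow x n \<odot> ((x \<odot> x) \<odot> y) = (x \<odot> x) \<odot> (jpow x n \<odot> y))"
proof (induction n rule: less_induct)
  case (less n)
  note comm = jordan_identity[of x, symmetric]
  show ?case
  proof (cases "n < 2")
    case True
    then have "n = 0 \<or> n = 1" by linarith
    then show ?thesis
      by (auto simp: jmult_identity jmult_identity_right comm)
  next
    case False
    then obtain m where n: "n = Suc (Suc m)" by (metis False add_2_eq_Suc le_Suc_ex not_le)
    have sq: "(x \<odot> x) \<odot> jpow x k = jpow x (Suc (Suc k))" for k
      by (induction k) (simp_all add: jmult_identity_right comm)
    have L: "jpow x n \<odot> v = 2 *\<^sub>R (jpow x (Suc m) \<odot> (x \<odot> v)) + (x \<odot> x) \<odot> (jpow x m \<odot> v)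
        - 2 *\<^sub>R (x \<odot> (jpow x m \<odot> (x \<odot> v)))" for v
      using jmult_triple[of x x "jpow x m" v] unfolding sq n
      by (simp add: scaleR_2 algebra_simps)
    have IH: "jpow x m \<odot> (x \<odot> y) = x \<odot> (jpow x m \<odot> y)"
      "jpow x m \<odot> ((x \<odot> x) \<odot> y) = (x \<odot> x) \<odot> (jpow x m \<odot> y)"
      "jpow x (Suc m) \<odot> (x \<odot> y) = x \<odot> (jpow x (Suc m) \<odot> y)"
      "jpow x (Suc m) \<odot> ((x \<odot> x) \<odot> y) = (x \<odot> x) \<odot> (jpow x (Suc m) \<odot> y)" for y
      using less.IH[of m] less.IH[of "Suc m"] n by (auto simp del: jpow.simps)
    show ?thesis
      unfolding L by (simp add: IH jmult_simps comm del: jpow.simps)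
  qed
qed

lemma jpow_mult: "jpow x m \<odot> jpow x n = jpow x (m + n)"
  by (induction n) (simp_all add: jmult_identity_right jpow_operators)

definition complete_system :: "'a set \<Rightarrow> bool"
  where "complete_system C \<longleftrightarrow> finite C \<and> (\<forall>c\<in>C. idempotent c \<and> c \<noteq> 0) \<and>
    (\<forall>c\<in>C. \<forall>d\<in>C. c \<noteq> d \<longrightarrow> c \<odot> d = 0) \<and> (\<Sum>c\<in>C. c) = e"

lemma jordan_frame_imp_complete_system: "jordan_frame C \<Longrightarrow> complete_system C"
  by (auto simp: jordan_frame_def complete_system_def primitive_idempotent_def)

lemma complete_system_mult:
  assumes "complete_system C" "c \<in> C"
  shows "(\<Sum>d\<in>C. l d *\<^sub>R d) \<odot> c = l c *\<^sub>R c"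
proof -
  have "(\<Sum>d\<in>C. l d *\<^sub>R d) \<odot> c = (\<Sum>d\<in>C. if d = c then l c *\<^sub>R c else 0)"
    unfolding jmult_sum_left using assms
    by (intro sum.cong) (auto simp: complete_system_def jmult_simps idempotent_def)
  then show ?thesis using assms by (simp add: complete_system_def)
qed

text \<open>On the span \<open>A\<close> of the powers of \<open>x\<close>, an eigenvector of
  \<open>x\<close> is an eigenvector of every element of \<open>A\<close>. The product of two
  different basis vectors is therefore a multiple of each of them, hence zero by orthogonality.
  Rescaled by the coefficients of \<open>e\<close>, the basis vectors become idempotents.\<close>

lemma spectral_complete_system:
  obtains C where "complete_system C" "\<forall>c\<in>C. \<exists>k. x \<odot> c = k *\<^sub>R c"
proof -
  define A where "A = span (range (jpow x))"
  have A: "subspace A" by (simp add: A_def)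
  have powA: "jpow x n \<in> A" for n by (simp add: A_def span_base)
  have inv: "x \<odot> v \<in> A" if "v \<in> A" for v
    using that unfolding A_def
  proof (induction rule: span_induct_alt)
    case (step k a v)
    then obtain n where "a = jpow x n" by auto
    then have "x \<odot> a \<in> span (range (jpow x))" by (metis jpow.simps(2) rangeI span_base)
    then show ?case using step by (auto simp: jmult_simps intro: span_add span_scale)
  qed (simp add: jmult_simps span_zero)
  have sa: "(x \<odot> v) \<bullet> w = v \<bullet> (x \<odot> w)" for v w by (rule inner_jmult)
  obtain B where B: "finite B" "B \<subseteq> A" "pairwise orthogonal B" "0 \<notin> B" "span B = A"
    and "\<forall>v\<in>B. \<exists>k. x \<odot> v = k *\<^sub>R v"
    using selfadjoint_eigenbasis[OF linear_jmult A inv sa] by blast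
  then have eig: "\<exists>k. x \<odot> v = k *\<^sub>R v" if "v \<in> B" for v using that by blast
  have pow_eig: "\<exists>k. jpow x n \<odot> v = k *\<^sub>R v" if v: "v \<in> B" for n v
  proof (induction n)
    case 0
    then show ?case by (auto simp: jmult_identity intro: exI[of _ 1])
  next
    case (Suc n)
    \<comment> \<open>This factorisation is claimed on \<open>A\<close> only, where powers
      associate; on the whole algebra multiplication by a power is not a power of the
      multiplication.\<close>
    have "jpow x (Suc n) \<odot> u = x \<odot> (jpow x n \<odot> u)" if "u \<in> A" for u
      using that unfolding A_def
    proof (induction rule: span_induct_alt)
      case (step k a u)
      then obtain m where "a = jpow x m" by auto
      then have "jpow x (Suc n) \<odot> a = x \<odot> (jpow x n \<odot> a)" by (simp only: jpow_mult) simp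
      then show ?case using step by (simp add: jmult_simps del: jpow.simps)
    qed (simp add: jmult_simps)
    then have "jpow x (Suc n) \<odot> v = x \<odot> (jpow x n \<odot> v)" using v B by blast
    then show ?case using Suc eig[OF v] by (auto simp: jmult_simps simp del: jpow.simps)
  qed
  have mult_eig: "\<exists>k. a \<odot> v = k *\<^sub>R v" if v: "v \<in> B" and a: "a \<in> A" for a v
    using a unfolding A_def
  proof (induction rule: span_induct_alt)
    case (step k a u)
    then obtain m where "a = jpow x m" by auto
    then obtain i j where "a \<odot> v = i *\<^sub>R v" "u \<odot> v = j *\<^sub>R v" using pow_eig[OF v] step by blast
    then have "(k *\<^sub>R a + u) \<odot> v = (k * i + j) *\<^sub>R v" by (simp add: jmult_simps algebra_simps)
    then show ?case by blast
  qed (auto simp: jmult_simps intro: exI[of _ 0])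
  have orth: "v \<odot> w = 0" if vw: "v \<in> B" "w \<in> B" "v \<noteq> w" for v w
  proof -
    obtain a b where a: "v \<odot> w = a *\<^sub>R w" and b: "w \<odot> v = b *\<^sub>R v"
      using mult_eig vw B by (metis subsetD)
    have "w \<bullet> v = 0" using vw B(3) by (metis orthogonal_def pairwise_def)
    moreover have "a *\<^sub>R w = b *\<^sub>R v" using a b jmult_commute by metis
    ultimately have "(a *\<^sub>R w) \<bullet> w = (b *\<^sub>R v) \<bullet> w" "v \<bullet> w = 0"
      by (simp_all add: inner_commute)
    then have "a = 0 \<or> w = 0" by simp
    then show ?thesis using a by auto
  qed
  have "e \<in> span B" using powA[of 0] B by simp
  then obtain \<alpha> where \<alpha>: "e = (\<Sum>v\<in>B. \<alpha> v *\<^sub>R v)"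
    using B(1) by (auto simp: span_finite)
  have idem: "\<alpha> v *\<^sub>R (v \<odot> v) = v" if v: "v \<in> B" for v
  proof -
    have "v = e \<odot> v" by (simp add: jmult_identity)
    also have "\<dots> = (\<Sum>w\<in>B. if w = v then \<alpha> v *\<^sub>R (v \<odot> v) else 0)"
      unfolding \<alpha> jmult_sum_left using orth v by (intro sum.cong) (auto simp: jmult_simps)
    also have "\<dots> = \<alpha> v *\<^sub>R (v \<odot> v)" using B v by simp
    finally show ?thesis by simp
  qed
  have nz: "\<alpha> v \<noteq> 0" if "v \<in> B" for v using idem[OF that] B(4) that by auto
  have inj: "inj_on (\<lambda>v. \<alpha> v *\<^sub>R v) B"
  proof (rule inj_onI, rule ccontr)
    fix v w assume h: "v \<in> B" "w \<in> B" "\<alpha> v *\<^sub>R v = \<alpha> w *\<^sub>R w" "v \<noteq> w"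
    then have "\<alpha> v *\<^sub>R v \<odot> v = 0"
      using orth[of w v] by (simp add: jmult_simps)
    then show False using idem[OF h(1)] h(1) B(4) by (simp add: jmult_simps)
  qed
  define C where "C = (\<lambda>v. \<alpha> v *\<^sub>R v) ` B"
  have "complete_system C"
    unfolding complete_system_def
  proof (intro conjI)
    show "finite C" using B by (simp add: C_def)
    show "\<forall>c\<in>C. idempotent c \<and> c \<noteq> 0"
      using nz B(4) idem by (auto simp: C_def idempotent_def jmult_simps)
    show "\<forall>c\<in>C. \<forall>d\<in>C. c \<noteq> d \<longrightarrow> c \<odot> d = 0"
    proof (intro ballI impI)
      fix c d assume "c \<in> C" "d \<in> C" "c \<noteq> d"
      then obtain v w where "v \<in> B" "w \<in> B" "c = \<alpha> v *\<^sub>R v" "d = \<alpha> w *\<^sub>R w" "v \<noteq> w"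
        unfolding C_def by blast
      then show "c \<odot> d = 0" using orth[of v w] by (simp add: jmult_simps)
    qed
    show "(\<Sum>c\<in>C. c) = e" unfolding C_def \<alpha> using inj by (simp add: sum.reindex)
  qed
  moreover have "\<exists>k. x \<odot> c = k *\<^sub>R c" if c: "c \<in> C" for c
  proof -
    obtain v where v: "v \<in> B" "c = \<alpha> v *\<^sub>R v" using c unfolding C_def by blast
    obtain k where "x \<odot> v = k *\<^sub>R v" using eig[OF v(1)] by blast
    then have "x \<odot> c = k *\<^sub>R c" by (simp add: v(2) jmult_simps)
    then show ?thesis by blast
  qed
  ultimately show ?thesis using that by blast
qed

lemma complete_system_expand:
  assumes "complete_system C" "\<And>c. c \<in> C \<Longrightarrow> x \<odot> c = l c *\<^sub>R c"
  shows "x = (\<Sum>c\<in>C. l c *\<^sub>R c)"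
proof -
  have "x = x \<odot> (\<Sum>c\<in>C. c)" using assms by (simp add: complete_system_def jmult_identity_right)
  then show ?thesis using assms by (simp add: jmult_sum_right)
qed

lemma complete_system_pairwise_orthogonal:
  assumes "complete_system C"
  shows "pairwise orthogonal C"
proof (rule pairwiseI)
  fix c d assume h: "c \<in> C" "d \<in> C" "c \<noteq> d"
  have "c \<bullet> d = (c \<odot> c) \<bullet> d" using h assms by (simp add: complete_system_def idempotent_def)
  also have "\<dots> = 0" using h assms unfolding inner_jmult by (simp add: complete_system_def)
  finally show "orthogonal c d" by (simp add: orthogonal_def)
qed

text \<open>For another member \<open>d\<close>, the sum
  \<open>u \<bullet> d + v \<bullet> d = c \<bullet> d\<close> is zero and both terms are
  nonnegative. Thus both vanish, and idempotents with inner product zero have product zero.\<close>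

lemma complete_system_refine:
  assumes C: "complete_system C" and c: "c \<in> C" "\<not> primitive_idempotent c"
  obtains u v where "u \<notin> C - {c}" "v \<notin> C - {c}" "u \<noteq> v" "c = u + v" "c \<odot> u = u" "c \<odot> v = v"
    "complete_system (insert u (insert v (C - {c})))"
proof -
  have fin: "finite C" using C by (simp add: complete_system_def)
  obtain u v where uv: "idempotent u" "idempotent v" "u \<noteq> 0" "v \<noteq> 0" "u \<odot> v = 0" "c = u + v"
    using c C by (auto simp: primitive_idempotent_def complete_system_def)
  have vu: "v \<odot> u = 0" using uv jmult_commute by metis
  have orth: "u \<odot> d = 0 \<and> v \<odot> d = 0" if d: "d \<in> C - {c}" for d
  proof -
    have di: "idempotent d" using d C by (simp add: complete_system_def)
    have "c \<bullet> d = 0" using complete_system_pairwise_orthogonal[OF C] c d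
      by (auto simp: pairwise_def orthogonal_def)
    then have "u \<bullet> d + v \<bullet> d = 0" by (simp add: uv(6) inner_simps)
    then have "u \<bullet> d = 0" "v \<bullet> d = 0"
      using idempotents_inner_nonneg[OF uv(1) di] idempotents_inner_nonneg[OF uv(2) di] by auto
    then show ?thesis using idempotents_orthogonal uv di by blast
  qed
  have u: "u \<notin> C - {c}" using orth[of u] uv by (auto simp: idempotent_def)
  have v: "v \<notin> C - {c}" using orth[of v] uv by (auto simp: idempotent_def)
  have ne: "u \<noteq> v" using uv by (auto simp: idempotent_def)
  have "(\<Sum>c\<in>insert u (insert v (C - {c})). c) = u + (v + (\<Sum>d\<in>C - {c}. d))"
    using u v ne fin by simp
  also have "\<dots> = (\<Sum>d\<in>C. d)" using fin c uv(6) by (simp add: sum.remove[of C c] algebra_simps)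
  also have "\<dots> = e" using C by (simp add: complete_system_def)
  finally have sum: "(\<Sum>c\<in>insert u (insert v (C - {c})). c) = e" .
  have orth': "d \<odot> u = 0 \<and> d \<odot> v = 0" if d: "d \<in> C - {c}" for d
    using orth[OF d] jmult_commute by metis
  have "complete_system (insert u (insert v (C - {c})))"
    unfolding complete_system_def
  proof (intro conjI)
    show "\<forall>a\<in>insert u (insert v (C - {c})). \<forall>b\<in>insert u (insert v (C - {c})). a \<noteq> b \<longrightarrow> a \<odot> b = 0"
      using C uv(5) vu orth orth' by (auto simp: complete_system_def)
    show "\<forall>a\<in>insert u (insert v (C - {c})). idempotent a \<and> a \<noteq> 0"
      using C uv(1-4) by (auto simp: complete_system_def)
  qed (use fin sum in simp_all)
  moreover have "c \<odot> u = u" "c \<odot> v = v" using uv vu by (auto simp: jmult_simps idempotent_def)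
  ultimately show ?thesis using that u v ne uv(6) by blast
qed

text \<open>Take a complete system of eigenvectors of \<open>x\<close> of largest cardinality, which
  the dimension bounds. A member that is not primitive could be split, and both halves inherit its
  eigenvalue.\<close>

lemma spectral_jordan_frame:
  obtains C l where "jordan_frame C" "x = (\<Sum>c\<in>C. l c *\<^sub>R c)"
proof -
  define P where "P C \<longleftrightarrow> complete_system C \<and> (\<forall>c\<in>C. \<exists>k. x \<odot> c = k *\<^sub>R c)" for C
  obtain C0 where "P C0" using spectral_complete_system[of x] unfolding P_def by blast
  moreover have "\<forall>C. P C \<longrightarrow> card C < Suc DIM('a)"
    using card_le_DIM_orthogonal[OF complete_system_pairwise_orthogonal]
    by (auto simp: P_def less_Suc_eq_le complete_system_def)
  ultimately obtain C where C: "P C" and max: "\<And>D. P D \<Longrightarrow> card D \<le> card C"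
    using ex_has_greatest_nat[of P C0 card "Suc DIM('a)"] by (metis less_imp_le)
  have CS: "complete_system C" using C by (simp add: P_def)
  obtain l where l: "\<And>c. c \<in> C \<Longrightarrow> x \<odot> c = l c *\<^sub>R c" 
    using C bchoice[of C "\<lambda>c k. x \<odot> c = k *\<^sub>R c"] unfolding P_def by blast
  have x: "x = (\<Sum>c\<in>C. l c *\<^sub>R c)" using complete_system_expand[OF CS l] .
  have "primitive_idempotent c" if c: "c \<in> C" for c
  proof (rule ccontr)
    assume "\<not> primitive_idempotent c"
    with CS c obtain u v where uv: "u \<notin> C - {c}" "v \<notin> C - {c}" "u \<noteq> v" "c = u + v"
      "c \<odot> u = u" "c \<odot> v = v" "complete_system (insert u (insert v (C - {c})))"
      by (rule complete_system_refine)
    let ?D = "insert u (insert v (C - {c}))"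
    have fin: "finite C" using CS by (simp add: complete_system_def)
    have eig: "x \<odot> w = l c *\<^sub>R w" if w: "w = u \<or> w = v" for w
    proof -
      have "d \<odot> w = 0" if "d \<in> C - {c}" for d
        using uv(1,2,7) w that by (auto simp: complete_system_def)
      then have "(\<Sum>d\<in>C. l d *\<^sub>R d) \<odot> w = (\<Sum>d\<in>C. if d = c then l c *\<^sub>R w else 0)"
        unfolding jmult_sum_left using w uv(5,6)
        by (intro sum.cong) (auto simp: jmult_simps)
      then have "x \<odot> w = (\<Sum>d\<in>C. if d = c then l c *\<^sub>R w else 0)"
        unfolding x[symmetric] .
      then show ?thesis using c fin by simp
    qed
    have "P ?D" unfolding P_def
    proof (intro conjI ballI)
      show "\<exists>k. x \<odot> w = k *\<^sub>R w" if "w \<in> ?D" for w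
        using that l[of w] eig[of w] by auto
    qed (rule uv(7))
    then have "card ?D \<le> card C" using max by blast
    moreover have "card ?D = Suc (card C)"
      using uv(1-3) fin c card_Suc_Diff1[of C c] by simp
    ultimately show False by simp
  qed
  then have "jordan_frame C" using CS by (auto simp: jordan_frame_def complete_system_def)
  then show ?thesis using that x by blast
qed

section \<open>Functional calculus, independent of the chosen decomposition\<close>

lemma jmult_sum_sum:
  "(\<Sum>i\<in>A. f i) \<odot> (\<Sum>j\<in>B. g j) = (\<Sum>i\<in>A. \<Sum>j\<in>B. f i \<odot> g j)"
  by (subst jmult_sum_left) (simp add: jmult_sum_right)

text \<open>Moving \<open>x\<close> across the inner product shows that \<open>l c = m d\<close> or
  \<open>c \<bullet> d = 0\<close>, and in the latter case \<open>c \<odot> d = 0\<close>.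
  Multiplying each side by the sum \<open>e\<close> of the other system then compares them product
  by product.\<close>

lemma spectral_sum_unique:
  assumes C: "complete_system C" and D: "complete_system D"
    and eq: "(\<Sum>c\<in>C. l c *\<^sub>R c) = (\<Sum>d\<in>D. m d *\<^sub>R d)"
  shows "(\<Sum>c\<in>C. f (l c) *\<^sub>R c) = (\<Sum>d\<in>D. f (m d) *\<^sub>R d)"
proof -
  define x where "x = (\<Sum>c\<in>C. l c *\<^sub>R c)"
  have key: "f (l c) *\<^sub>R (c \<odot> d) = f (m d) *\<^sub>R (c \<odot> d)" if c: "c \<in> C" and d: "d \<in> D" for c d
  proof (cases "l c = m d")
    case False
    have "l c * (c \<bullet> d) = (x \<odot> c) \<bullet> d"
      using complete_system_mult[OF C c, of l] by (simp add: x_def)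
    also have "\<dots> = m d * (c \<bullet> d)"
      unfolding inner_jmult using complete_system_mult[OF D d, of m] by (simp add: x_def eq)
    finally have "c \<bullet> d = 0" using False by simp
    then have "c \<odot> d = 0"
      using idempotents_orthogonal C D c d by (simp add: complete_system_def)
    then show ?thesis by simp
  qed simp
  have "(\<Sum>c\<in>C. f (l c) *\<^sub>R c) = (\<Sum>c\<in>C. f (l c) *\<^sub>R c) \<odot> (\<Sum>d\<in>D. d)"
    using D by (simp add: complete_system_def jmult_identity_right)
  also have "\<dots> = (\<Sum>c\<in>C. \<Sum>d\<in>D. f (l c) *\<^sub>R (c \<odot> d))"
    by (simp only: jmult_sum_sum jmult_scale_left)
  also have "\<dots> = (\<Sum>c\<in>C. \<Sum>d\<in>D. f (m d) *\<^sub>R (c \<odot> d))"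
    using key by (intro sum.cong refl) auto
  also have "\<dots> = (\<Sum>c\<in>C. c) \<odot> (\<Sum>d\<in>D. f (m d) *\<^sub>R d)"
    by (simp only: jmult_sum_sum jmult_scale_right)
  also have "\<dots> = (\<Sum>d\<in>D. f (m d) *\<^sub>R d)"
    using C by (simp add: complete_system_def jmult_identity)
  finally show ?thesis .
qed

text \<open>The description in \<open>jordan_power\<close> with an arbitrary function in place of
  \<open>powr\<close>, so that powers and inversion share one calculus.\<close>

definition spectral_fun :: "(real \<Rightarrow> real) \<Rightarrow> 'a \<Rightarrow> 'a"
  where "spectral_fun f x = (THE y. \<exists>C l. jordan_frame C \<and>
    x = (\<Sum>c\<in>C. l c *\<^sub>R c) \<and> y = (\<Sum>c\<in>C. f (l c) *\<^sub>R c))"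

lemma jordan_power_eq_spectral_fun: "jordan_power x p = spectral_fun (\<lambda>s. s powr p) x"
  by (simp add: jordan_power_def spectral_fun_def)

lemma spectral_fun_eq:
  assumes "complete_system C"
  shows "spectral_fun f (\<Sum>c\<in>C. l c *\<^sub>R c) = (\<Sum>c\<in>C. f (l c) *\<^sub>R c)"
  unfolding spectral_fun_def
proof (rule the_equality)
  obtain D m where D: "jordan_frame D" and eq: "(\<Sum>c\<in>C. l c *\<^sub>R c) = (\<Sum>d\<in>D. m d *\<^sub>R d)"
    using spectral_jordan_frame .
  show "\<exists>D m. jordan_frame D \<and> (\<Sum>c\<in>C. l c *\<^sub>R c) = (\<Sum>c\<in>D. m c *\<^sub>R c) \<and>
      (\<Sum>c\<in>C. f (l c) *\<^sub>R c) = (\<Sum>c\<in>D. f (m c) *\<^sub>R c)"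
    using D eq spectral_sum_unique[OF assms jordan_frame_imp_complete_system[OF D] eq]
    by (intro exI conjI)
next
  fix y assume "\<exists>D m. jordan_frame D \<and> (\<Sum>c\<in>C. l c *\<^sub>R c) = (\<Sum>c\<in>D. m c *\<^sub>R c) \<and>
      y = (\<Sum>c\<in>D. f (m c) *\<^sub>R c)"
  then obtain D m where D: "jordan_frame D" and eq: "(\<Sum>c\<in>C. l c *\<^sub>R c) = (\<Sum>c\<in>D. m c *\<^sub>R c)"
    and y: "y = (\<Sum>c\<in>D. f (m c) *\<^sub>R c)" by (elim exE conjE)
  show "y = (\<Sum>c\<in>C. f (l c) *\<^sub>R c)"
    unfolding y spectral_sum_unique[OF assms jordan_frame_imp_complete_system[OF D] eq] ..
qed

lemma spectral_decomposition:
  obtains C l where "complete_system C" "x = (\<Sum>c\<in>C. l c *\<^sub>R c)"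
  by (rule spectral_jordan_frame[of x]) (rule that[OF jordan_frame_imp_complete_system])

section \<open>The cone of squares\<close>

definition nonneg_cone :: "'a set"
  where "nonneg_cone = {x \<odot> x |x. True}"

lemma complete_system_inner:
  assumes "complete_system C" "c \<in> C"
  shows "(\<Sum>d\<in>C. l d *\<^sub>R d) \<bullet> c = l c * (c \<bullet> c)"
proof -
  have "(\<Sum>d\<in>C. l d *\<^sub>R d) \<bullet> c = (\<Sum>d\<in>C. if d = c then l c * (c \<bullet> c) else 0)"
    unfolding inner_sum_left using complete_system_pairwise_orthogonal[OF assms(1)] assms(2)
    by (intro sum.cong) (auto simp: pairwise_def orthogonal_def)
  then show ?thesis using assms by (simp add: complete_system_def)
qed

text \<open>A square pairs with \<open>c\<close> as the quadratic form of multiplication by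
  \<open>c\<close>, which is positive semidefinite. Conversely, the spectral idempotents of
  \<open>x\<close> detect the signs of its eigenvalues, and nonnegative ones have square
  roots.\<close>

lemma nonneg_cone_iff: "x \<in> nonneg_cone \<longleftrightarrow> (\<forall>c. idempotent c \<longrightarrow> 0 \<le> x \<bullet> c)"
proof safe
  fix c assume "x \<in> nonneg_cone" and c: "idempotent c"
  then obtain u where "x = u \<odot> u" by (auto simp: nonneg_cone_def)
  then have "x \<bullet> c = (c \<odot> u) \<bullet> u"
    using inner_jmult[of u u c] by (simp add: inner_commute jmult_commute[of c u])
  then show "0 \<le> x \<bullet> c" using idempotent_psd[OF c] by simp
next
  assume x: "\<forall>c. idempotent c \<longrightarrow> 0 \<le> x \<bullet> c"
  obtain C l where C: "complete_system C" and xC: "x = (\<Sum>c\<in>C. l c *\<^sub>R c)"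
    using spectral_decomposition .
  have l: "0 \<le> l c" if "c \<in> C" for c
  proof -
    have "idempotent c" "c \<noteq> 0" using that C by (auto simp: complete_system_def)
    then have "0 \<le> l c * (c \<bullet> c)" "0 < c \<bullet> c"
      using x complete_system_inner[OF C that, of l] by (auto simp: xC)
    then show ?thesis by (simp add: zero_le_mult_iff)
  qed
  let ?u = "\<Sum>c\<in>C. sqrt (l c) *\<^sub>R c"
  have "?u \<odot> ?u = (\<Sum>c\<in>C. sqrt (l c) *\<^sub>R (?u \<odot> c))"
    by (subst jmult_sum_right) (simp add: jmult_simps)
  also have "\<dots> = x"
    unfolding xC using complete_system_mult[OF C, of _ "\<lambda>c. sqrt (l c)"] l
    by (intro sum.cong) (auto simp: abs_of_nonneg)
  finally show "x \<in> nonneg_cone" unfolding nonneg_cone_def by blast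
qed

lemma zero_in_nonneg_cone: "0 \<in> nonneg_cone"
  by (simp add: nonneg_cone_iff)

lemma nonneg_cone_add: "x \<in> nonneg_cone \<Longrightarrow> y \<in> nonneg_cone \<Longrightarrow> x + y \<in> nonneg_cone"
  by (simp add: nonneg_cone_iff inner_simps)

lemma nonneg_cone_scale: "x \<in> nonneg_cone \<Longrightarrow> 0 \<le> k \<Longrightarrow> k *\<^sub>R x \<in> nonneg_cone"
  by (simp add: nonneg_cone_iff)

lemma nonneg_cone_limit:
  assumes "eventually (\<lambda>n. X n \<in> nonneg_cone) F" "(X \<longlongrightarrow> x) F" "F \<noteq> bot"
  shows "x \<in> nonneg_cone"
  unfolding nonneg_cone_iff
proof safe
  fix c assume "idempotent c"
  then have "eventually (\<lambda>n. 0 \<le> X n \<bullet> c) F"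
    using assms(1) by (auto elim: eventually_mono simp: nonneg_cone_iff)
  moreover have "((\<lambda>n. X n \<bullet> c) \<longlongrightarrow> x \<bullet> c) F" using assms(2) by (intro tendsto_intros)
  ultimately show "0 \<le> x \<bullet> c" using tendsto_lowerbound assms(3) by blast
qed

lemma nonneg_cone_spectral:
  assumes C: "complete_system C"
  shows "(\<Sum>c\<in>C. l c *\<^sub>R c) \<in> nonneg_cone \<longleftrightarrow> (\<forall>c\<in>C. 0 \<le> l c)"
proof
  assume x: "(\<Sum>c\<in>C. l c *\<^sub>R c) \<in> nonneg_cone"
  show "\<forall>c\<in>C. 0 \<le> l c"
  proof
    fix c assume "c \<in> C"
    then have "idempotent c" "0 < c \<bullet> c" using C by (auto simp: complete_system_def)
    then have "0 \<le> l c * (c \<bullet> c)" "0 < c \<bullet> c"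
      using x complete_system_inner[OF C \<open>c \<in> C\<close>, of l] by (metis nonneg_cone_iff)+
    then show "0 \<le> l c" by (simp add: zero_le_mult_iff)
  qed
next
  assume "\<forall>c\<in>C. 0 \<le> l c"
  then show "(\<Sum>c\<in>C. l c *\<^sub>R c) \<in> nonneg_cone"
    using C by (auto simp: nonneg_cone_iff inner_sum_left complete_system_def
        intro!: sum_nonneg mult_nonneg_nonneg idempotents_inner_nonneg)
qed

lemma identity_nonzero: "e \<noteq> 0"
proof
  assume "e = 0"
  obtain b :: 'a where "b \<in> Basis" using nonempty_Basis by blast
  then have "b \<noteq> 0" by (rule nonzero_Basis)
  moreover have "b = 0" using jmult_identity[of b] \<open>e = 0\<close> by (simp add: jmult_simps)
  ultimately show False by simp
qed

lemma idempotent_identity: "idempotent e"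
  by (simp add: idempotent_def jmult_identity)

lemma symmetric_cone_iff: "x \<in> symmetric_cone \<longleftrightarrow> (\<exists>\<epsilon>>0. x - \<epsilon> *\<^sub>R e \<in> nonneg_cone)"
proof
  assume "x \<in> symmetric_cone"
  then have "x \<in> interior nonneg_cone" by (simp add: symmetric_cone_def nonneg_cone_def)
  then obtain \<delta> where \<delta>: "\<delta> > 0" "cball x \<delta> \<subseteq> nonneg_cone"
    unfolding mem_interior_cball by blast
  have "dist x (x - (\<delta> / norm e) *\<^sub>R e) = \<delta>" using \<delta> identity_nonzero by (simp add: dist_norm)
  then have "x - (\<delta> / norm e) *\<^sub>R e \<in> nonneg_cone" using \<delta> by (auto simp: subset_iff)
  then show "\<exists>\<epsilon>>0. x - \<epsilon> *\<^sub>R e \<in> nonneg_cone"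
    using \<delta> identity_nonzero by (intro exI[of _ "\<delta> / norm e"]) auto
next
  assume "\<exists>\<epsilon>>0. x - \<epsilon> *\<^sub>R e \<in> nonneg_cone"
  then obtain \<epsilon> where \<epsilon>: "\<epsilon> > 0" "x - \<epsilon> *\<^sub>R e \<in> nonneg_cone" by blast
  obtain B where B: "B > 0" "\<And>u v. norm (u \<odot> v) \<le> B * norm u * norm v"
    using bilinear_bounded_pos[OF bilinear_jmult] by blast
  have "y \<in> nonneg_cone" if y: "y \<in> ball x (\<epsilon> / B)" for y
    unfolding nonneg_cone_iff
  proof safe
    fix c assume c: "idempotent c"
    show "0 \<le> y \<bullet> c"
    proof (cases "c = 0")
      case False
      \<comment> \<open>Nonzero idempotents are bounded away from 0, so one radius
        \<open>\<epsilon> / B\<close> serves all of them.\<close>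
      have "norm c \<le> B * norm c * norm c" using B(2)[of c c] c by (simp add: idempotent_def)
      then have Bc: "1 \<le> B * norm c" using False by simp
      have "\<bar>(x - y) \<bullet> c\<bar> \<le> norm (x - y) * norm c" by (rule Cauchy_Schwarz_ineq2)
      also have "\<dots> \<le> (\<epsilon> / B) * norm c"
        using y by (intro mult_right_mono) (auto simp: dist_norm)
      also have "\<dots> \<le> (\<epsilon> / B) * norm c * (B * norm c)"
        using mult_left_mono[OF Bc, of "(\<epsilon> / B) * norm c"] \<epsilon> B by simp
      also have "\<dots> = \<epsilon> * (e \<bullet> c)"
        using B(1) idempotent_inner_self[OF c]
        by (simp add: inner_commute dot_square_norm power2_eq_square)
      finally have "(x - y) \<bullet> c \<le> \<epsilon> * (e \<bullet> c)" by simp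
      moreover have "0 \<le> (x - \<epsilon> *\<^sub>R e) \<bullet> c" using \<epsilon> c nonneg_cone_iff by blast
      ultimately show ?thesis by (simp add: inner_simps)
    qed simp
  qed
  moreover have "x \<in> ball x (\<epsilon> / B)" using \<epsilon> B by simp
  ultimately show "x \<in> symmetric_cone"
    unfolding symmetric_cone_def nonneg_cone_def[symmetric]
    by (meson interiorI open_ball subsetI)
qed

lemma symmetric_cone_subset: "symmetric_cone \<subseteq> nonneg_cone"
  by (simp add: symmetric_cone_def nonneg_cone_def interior_subset)

lemma complete_system_shift:
  assumes "complete_system C"
  shows "(\<Sum>c\<in>C. l c *\<^sub>R c) + k *\<^sub>R e = (\<Sum>c\<in>C. (l c + k) *\<^sub>R c)"
proof -
  have "k *\<^sub>R e = (\<Sum>c\<in>C. k *\<^sub>R c)"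
    using assms by (simp add: complete_system_def flip: scaleR_sum_right)
  then show ?thesis by (simp add: sum.distrib scaleR_left_distrib)
qed

lemma symmetric_cone_spectral:
  assumes C: "complete_system C"
  shows "(\<Sum>c\<in>C. l c *\<^sub>R c) \<in> symmetric_cone \<longleftrightarrow> (\<forall>c\<in>C. 0 < l c)"
proof -
  have shift: "(\<Sum>c\<in>C. l c *\<^sub>R c) - \<epsilon> *\<^sub>R e = (\<Sum>c\<in>C. (l c - \<epsilon>) *\<^sub>R c)" for \<epsilon>
    using complete_system_shift[OF C, of l "- \<epsilon>"] by simp
  have "(\<exists>\<epsilon>>0. \<forall>c\<in>C. \<epsilon> \<le> l c) \<longleftrightarrow> (\<forall>c\<in>C. 0 < l c)"
  proof
    have fin: "finite C" and ne: "C \<noteq> {}"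
      using C identity_nonzero by (auto simp: complete_system_def)
    assume "\<forall>c\<in>C. 0 < l c"
    then have "Min (l ` C) > 0" "\<forall>c\<in>C. Min (l ` C) \<le> l c" using fin ne by auto
    then show "\<exists>\<epsilon>>0. \<forall>c\<in>C. \<epsilon> \<le> l c" by blast
  qed force
  then show ?thesis unfolding symmetric_cone_iff shift nonneg_cone_spectral[OF C] by simp
qed

lemma symmetric_cone_inner_pos:
  assumes "x \<in> symmetric_cone" "idempotent c" "c \<noteq> 0"
  shows "0 < x \<bullet> c"
proof -
  obtain \<epsilon> where \<epsilon>: "\<epsilon> > 0" "x - \<epsilon> *\<^sub>R e \<in> nonneg_cone" using assms symmetric_cone_iff by blast
  have "0 \<le> (x - \<epsilon> *\<^sub>R e) \<bullet> c" using \<epsilon> assms nonneg_cone_iff by blast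
  moreover have "0 < \<epsilon> * (c \<bullet> c)" using \<epsilon> assms by simp
  ultimately show ?thesis
    using idempotent_inner_self[OF assms(2)] by (simp add: inner_simps inner_commute)
qed

lemma symmetric_cone_add:
  assumes "x \<in> symmetric_cone" "y \<in> nonneg_cone"
  shows "x + y \<in> symmetric_cone"
proof -
  obtain \<epsilon> where \<epsilon>: "\<epsilon> > 0" "x - \<epsilon> *\<^sub>R e \<in> nonneg_cone" using assms symmetric_cone_iff by blast
  then have "x + y - \<epsilon> *\<^sub>R e \<in> nonneg_cone"
    using nonneg_cone_add[OF \<epsilon>(2) assms(2)] by (simp add: algebra_simps)
  then show ?thesis using \<epsilon> symmetric_cone_iff by blast
qed

text \<open>A Lyapunov argument: if \<open>c\<close> is a spectral idempotent of \<open>z\<close> with eigenvalue \<open>\<lambda>\<close>, then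
  \<open>(a \<odot> z) \<bullet> c = \<lambda> (a \<bullet> c)\<close>.\<close>

lemma nonneg_cone_jmult_cancel:
  assumes a: "a \<in> symmetric_cone" and az: "a \<odot> z \<in> nonneg_cone"
  shows "z \<in> nonneg_cone"
proof -
  obtain C l where C: "complete_system C" and z: "z = (\<Sum>c\<in>C. l c *\<^sub>R c)"
    using spectral_decomposition .
  have "0 \<le> l c" if c: "c \<in> C" for c
  proof -
    have ci: "idempotent c" "c \<noteq> 0" using C c by (auto simp: complete_system_def)
    have "(a \<odot> z) \<bullet> c = a \<bullet> (z \<odot> c)" by (subst jmult_commute) (rule inner_jmult)
    also have "\<dots> = l c * (a \<bullet> c)" using complete_system_mult[OF C c, of l] by (simp add: z)
    finally have "0 \<le> l c * (a \<bullet> c)" using az ci nonneg_cone_iff by metis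
    then show ?thesis
      using symmetric_cone_inner_pos[OF a ci] by (simp add: zero_le_mult_iff)
  qed
  then show ?thesis unfolding z using nonneg_cone_spectral[OF C] by blast
qed

lemma nonneg_cone_antisym:
  assumes "x \<in> nonneg_cone" "- x \<in> nonneg_cone"
  shows "x = 0"
proof -
  obtain C l where C: "complete_system C" and x: "x = (\<Sum>c\<in>C. l c *\<^sub>R c)"
    using spectral_decomposition .
  have "- x = (\<Sum>c\<in>C. (- l c) *\<^sub>R c)" by (simp add: x sum_negf)
  then have "\<forall>c\<in>C. 0 \<le> l c" "\<forall>c\<in>C. 0 \<le> - l c"
    using assms nonneg_cone_spectral[OF C, of l] nonneg_cone_spectral[OF C, of "\<lambda>c. - l c"] x
    by simp_all
  then have "\<forall>c\<in>C. l c = 0" by force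
  then show ?thesis by (simp add: x)
qed

lemma symmetric_cone_jmult_inject:
  assumes "a \<in> symmetric_cone" "a \<odot> y = a \<odot> z"
  shows "y = z"
proof -
  have "a \<odot> (y - z) \<in> nonneg_cone" "a \<odot> (- (y - z)) \<in> nonneg_cone"
    using assms zero_in_nonneg_cone by (simp_all add: jmult_simps)
  then have "y - z \<in> nonneg_cone" "- (y - z) \<in> nonneg_cone"
    using nonneg_cone_jmult_cancel[OF assms(1)] by blast+
  then show ?thesis using nonneg_cone_antisym by fastforce
qed

section \<open>Peirce decomposition and monotonicity of inversion\<close>

lemma orthogonal_idempotents_commute:
  assumes "idempotent c" "idempotent d" "c \<odot> d = 0"
  shows "c \<odot> (d \<odot> x) = d \<odot> (c \<odot> x)"
  using jordan_identity_linearized[of d c x] assms by (simp add: idempotent_def jmult_simps)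

text \<open>The case \<open>w = z = c\<close>, \<open>y = d\<close> of \<open>jmult_triple\<close>:
  the image of \<open>c \<odot> (d \<odot> x)\<close> lies in the 1/2-eigenspace of
  \<open>c\<close>.\<close>

lemma orthogonal_idempotents_half:
  assumes "idempotent c" "idempotent d" "c \<odot> d = 0"
  shows "2 *\<^sub>R (c \<odot> (c \<odot> (d \<odot> x))) = c \<odot> (d \<odot> x)"
proof -
  have "2 *\<^sub>R (c \<odot> (d \<odot> (c \<odot> x))) = c \<odot> (d \<odot> x)"
    using jmult_triple[of c c d x] assms by (simp add: idempotent_def jmult_simps scaleR_2 algebra_simps)
  then show ?thesis by (simp add: orthogonal_idempotents_commute[OF assms])
qed

text \<open>The preceding lemma for the idempotent \<open>a + b\<close>, which is orthogonal to
  \<open>c\<close>. The pure terms cancel by the same lemma for \<open>a\<close> and for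
  \<open>b\<close>, and the two equal cross terms remain.\<close>

lemma orthogonal_idempotents_triple:
  assumes "idempotent a" "idempotent b" "idempotent c" "a \<odot> b = 0" "a \<odot> c = 0" "b \<odot> c = 0"
  shows "a \<odot> (b \<odot> (c \<odot> x)) = 0"
proof -
  have "b \<odot> a = 0" using assms jmult_commute by metis
  then have "idempotent (a + b)" "(a + b) \<odot> c = 0"
    using assms by (simp_all add: idempotent_def jmult_simps)
  from orthogonal_idempotents_half[OF this(1) assms(3) this(2), of x]
  have "2 *\<^sub>R (a \<odot> (a \<odot> (c \<odot> x))) + 2 *\<^sub>R (b \<odot> (a \<odot> (c \<odot> x)))
      + (2 *\<^sub>R (a \<odot> (b \<odot> (c \<odot> x))) + 2 *\<^sub>R (b \<odot> (b \<odot> (c \<odot> x))))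
    = a \<odot> (c \<odot> x) + b \<odot> (c \<odot> x)"
    by (simp only: jmult_add_left jmult_add_right scaleR_right_distrib)
  then have eq: "a \<odot> (c \<odot> x) + 2 *\<^sub>R (b \<odot> (a \<odot> (c \<odot> x)))
      + (2 *\<^sub>R (a \<odot> (b \<odot> (c \<odot> x))) + b \<odot> (c \<odot> x)) = a \<odot> (c \<odot> x) + b \<odot> (c \<odot> x)"
    unfolding orthogonal_idempotents_half[OF assms(1,3,5)] orthogonal_idempotents_half[OF assms(2,3,6)] .
  have "2 *\<^sub>R (b \<odot> (a \<odot> (c \<odot> x))) + 2 *\<^sub>R (a \<odot> (b \<odot> (c \<odot> x)))
    = (a \<odot> (c \<odot> x) + 2 *\<^sub>R (b \<odot> (a \<odot> (c \<odot> x)))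
      + (2 *\<^sub>R (a \<odot> (b \<odot> (c \<odot> x))) + b \<odot> (c \<odot> x))) - (a \<odot> (c \<odot> x) + b \<odot> (c \<odot> x))"
    by simp
  then have "2 *\<^sub>R (b \<odot> (a \<odot> (c \<odot> x))) + 2 *\<^sub>R (a \<odot> (b \<odot> (c \<odot> x))) = 0"
    unfolding eq by simp
  then show ?thesis
    using orthogonal_idempotents_commute[OF assms(1,2,4)] by (simp flip: scaleR_left_distrib)
qed

lemma peirce_decomposition:
  assumes C: "complete_system C"
  obtains H where "h = (\<Sum>i\<in>C. \<Sum>j\<in>C. H i j)"
    "\<forall>\<nu>. \<forall>i\<in>C. \<forall>j\<in>C. (\<Sum>k\<in>C. \<nu> k *\<^sub>R k) \<odot> H i j = ((\<nu> i + \<nu> j) / 2) *\<^sub>R H i j"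
proof -
  \<comment> \<open>For i = j this is the projection onto the 1-eigenspace of \<open>i\<close>: 2
    t^2 - t sends 0, 1/2, 1 to 0, 0, 1. For i \<noteq> j the joint component is shared evenly
    between the pairs (i, j) and (j, i).\<close>
  define H where "H i j = 2 *\<^sub>R (i \<odot> (j \<odot> h)) - (if i = j then i \<odot> h else 0)" for i j
  have fin: "finite C" and idem: "\<And>c. c \<in> C \<Longrightarrow> idempotent c" and sum: "(\<Sum>c\<in>C. c) = e"
    and orth: "\<And>c d. c \<in> C \<Longrightarrow> d \<in> C \<Longrightarrow> c \<noteq> d \<Longrightarrow> c \<odot> d = 0"
    using C by (auto simp: complete_system_def)
  have k: "k \<odot> H i j = ((if k = i then 1/2 else 0) + (if k = j then 1/2 else 0)) *\<^sub>R H i j"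
    if ijk: "i \<in> C" "j \<in> C" "k \<in> C" for i j k
  proof -
    note half = orthogonal_idempotents_half[OF idem idem orth]
    note comm = orthogonal_idempotents_commute[OF idem idem orth]
    consider "i = j" "k = i" | "i = j" "k \<noteq> i" | "i \<noteq> j" "k = i" | "i \<noteq> j" "k = j"
      | "i \<noteq> j" "k \<noteq> i" "k \<noteq> j" by blast
    then show ?thesis
    proof cases
      case 1
      then show ?thesis
        using 1 idempotent_cubic[OF idem[OF ijk(1)], of h]
          scaleR_left_distrib[of 2 1 "i \<odot> (i \<odot> h)"]
        by (simp add: H_def jmult_simps scaleR_2 algebra_simps)
    next
      case 2
      have "k \<odot> (i \<odot> (i \<odot> h)) = i \<odot> (i \<odot> (k \<odot> h))"
        using comm[of k i "i \<odot> h"] comm[of k i h] 2 ijk by simp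
      then show ?thesis using 2 half[of i k h] ijk comm[of k i h]
        by (simp add: H_def jmult_simps)
    next
      case 3
      then show ?thesis using half[of i j h] ijk by (simp add: H_def jmult_simps)
    next
      case 4
      then show ?thesis using half[of j i h] comm[of i j h] ijk by (simp add: H_def jmult_simps)
    next
      case 5
      then show ?thesis
        using orthogonal_idempotents_triple[of k i j h] idem orth ijk
        by (simp add: H_def jmult_simps)
    qed
  qed
  have "(\<Sum>i\<in>C. \<Sum>j\<in>C. H i j) = 2 *\<^sub>R (\<Sum>i\<in>C. \<Sum>j\<in>C. i \<odot> (j \<odot> h)) - (\<Sum>i\<in>C. i \<odot> h)"
    using fin by (simp add: H_def sum_subtractf scaleR_sum_right)
  also have "(\<Sum>i\<in>C. \<Sum>j\<in>C. i \<odot> (j \<odot> h)) = (\<Sum>i\<in>C. i) \<odot> ((\<Sum>j\<in>C. j) \<odot> h)"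
    by (simp only: jmult_sum_left[of "\<lambda>j. j" C h] jmult_sum_sum)
  also have "\<dots> = h" by (simp add: sum jmult_identity)
  also have "(\<Sum>i\<in>C. i \<odot> h) = (\<Sum>i\<in>C. i) \<odot> h" by (simp add: jmult_sum_left)
  also have "\<dots> = h" by (simp add: sum jmult_identity)
  finally have "h = (\<Sum>i\<in>C. \<Sum>j\<in>C. H i j)" by (simp add: scaleR_2)
  moreover have "(\<Sum>k\<in>C. \<nu> k *\<^sub>R k) \<odot> H i j = ((\<nu> i + \<nu> j) / 2) *\<^sub>R H i j"
    if ij: "i \<in> C" "j \<in> C" for \<nu> i j
  proof -
    have "(\<Sum>k\<in>C. \<nu> k *\<^sub>R k) \<odot> H i j = (\<Sum>k\<in>C. (\<nu> k * ((if k = i then 1/2 else 0) + (if k = j then 1/2 else 0))) *\<^sub>R H i j)"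
      unfolding jmult_sum_left using k ij by (intro sum.cong) (auto simp: jmult_scale_left)
    also have "\<dots> = (\<Sum>k\<in>C. (if k = i then \<nu> i / 2 else 0) + (if k = j then \<nu> j / 2 else 0)) *\<^sub>R H i j"
      unfolding scaleR_sum_left by (intro sum.cong) auto
    also have "\<dots> = ((\<nu> i + \<nu> j) / 2) *\<^sub>R H i j"
      using fin ij by (simp add: sum.distrib add_divide_distrib)
    finally show ?thesis .
  qed
  ultimately show ?thesis by (intro that[of H]) simp_all
qed

text \<open>On the Peirce component \<open>(i, j)\<close> the inverse of multiplication by \<open>\<Sum>k\<in>C. \<nu> k *\<^sub>R k\<close> is
  division by \<open>(\<nu> i + \<nu> j) / 2\<close>.  With \<open>\<nu> = 1 + (2 / n) ln l\<close>, the \<open>n\<close>-th power of this inverse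
  tends to division by \<open>l i * l j\<close>.\<close>

lemma symmetric_cone_quadratic_cancel:
  assumes x: "x \<in> symmetric_cone" and h: "h \<in> nonneg_cone"
    and w: "x \<odot> w = spectral_fun inverse x \<odot> h"
  shows "w \<in> nonneg_cone"
proof -
  obtain C l where C: "complete_system C" and xC: "x = (\<Sum>c\<in>C. l c *\<^sub>R c)"
    using spectral_decomposition .
  have fin: "finite C" using C by (simp add: complete_system_def)
  have l: "\<And>c. c \<in> C \<Longrightarrow> 0 < l c" using symmetric_cone_spectral[OF C] x xC by blast
  obtain H where hH: "h = (\<Sum>i\<in>C. \<Sum>j\<in>C. H i j)"
    and "\<forall>\<nu>. \<forall>i\<in>C. \<forall>j\<in>C. (\<Sum>k\<in>C. \<nu> k *\<^sub>R k) \<odot> H i j = ((\<nu> i + \<nu> j) / 2) *\<^sub>R H i j"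
    by (rule peirce_decomposition[OF C, of h])
  then have H: "(\<Sum>k\<in>C. \<nu> k *\<^sub>R k) \<odot> H i j = ((\<nu> i + \<nu> j) / 2) *\<^sub>R H i j"
    if "i \<in> C" "j \<in> C" for \<nu> i j using that by simp
  \<comment> \<open>\<open>S f\<close> rescales each Peirce component of \<open>h\<close>;
    multiplications by elements with spectral system \<open>C\<close> act on it through
    \<open>f\<close> alone.\<close>
  define S where "S f = (\<Sum>i\<in>C. \<Sum>j\<in>C. f i j *\<^sub>R H i j)" for f :: "'a \<Rightarrow> 'a \<Rightarrow> real"
  have S_cong: "S f = S g" if "\<And>i j. i \<in> C \<Longrightarrow> j \<in> C \<Longrightarrow> f i j = g i j" for f g
    unfolding S_def using that by (intro sum.cong refl) simp
  have mult_S: "(\<Sum>k\<in>C. \<nu> k *\<^sub>R k) \<odot> S f = S (\<lambda>i j. f i j * ((\<nu> i + \<nu> j) / 2))" for \<nu> f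
    unfolding S_def jmult_sum_right using H by (intro sum.cong refl) (simp add: jmult_scale_right)
  have pow: "S (\<lambda>i j. (2 / (\<nu> i + \<nu> j)) ^ m) \<in> nonneg_cone"
    if \<nu>: "\<And>c. c \<in> C \<Longrightarrow> 0 < \<nu> c" for \<nu> m
  proof (induction m)
    case 0
    then show ?case using h hH by (simp add: S_def)
  next
    case (Suc m)
    have "(\<Sum>k\<in>C. \<nu> k *\<^sub>R k) \<odot> S (\<lambda>i j. (2 / (\<nu> i + \<nu> j)) ^ Suc m) = S (\<lambda>i j. (2 / (\<nu> i + \<nu> j)) ^ m)"
      unfolding mult_S
    proof (rule S_cong)
      fix i j assume "i \<in> C" "j \<in> C"
      then have "\<nu> i + \<nu> j > 0" using \<nu> by (simp add: add_pos_pos)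
      then have "2 / (\<nu> i + \<nu> j) * ((\<nu> i + \<nu> j) / 2) = 1" by simp
      then show "(2 / (\<nu> i + \<nu> j)) ^ Suc m * ((\<nu> i + \<nu> j) / 2) = (2 / (\<nu> i + \<nu> j)) ^ m"
        by (simp only: power_Suc mult_ac) simp
    qed
    then have "(\<Sum>k\<in>C. \<nu> k *\<^sub>R k) \<odot> S (\<lambda>i j. (2 / (\<nu> i + \<nu> j)) ^ Suc m) \<in> nonneg_cone"
      using Suc by simp
    moreover have "(\<Sum>k\<in>C. \<nu> k *\<^sub>R k) \<in> symmetric_cone"
      using symmetric_cone_spectral[OF C, of \<nu>] \<nu> by simp
    ultimately show ?case by (rule nonneg_cone_jmult_cancel[rotated])
  qed
  define \<nu> where "\<nu> n c = 1 + 2 * ln (l c) / real n" for n c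
  \<comment> \<open>\<open>ln (l c)\<close> may be negative, so positivity of the multiplier holds
    only for large \<open>n\<close>.\<close>
  have "eventually (\<lambda>n. \<forall>c\<in>C. 0 < \<nu> n c) sequentially"
  proof (rule eventually_ball_finite[OF fin], rule ballI)
    fix c
    have "(\<lambda>n. \<nu> n c) \<longlonglongrightarrow> 1 + 0"
      unfolding \<nu>_def by (intro tendsto_add tendsto_const lim_const_over_n)
    then show "eventually (\<lambda>n. 0 < \<nu> n c) sequentially"
      by (rule order_tendstoD) simp
  qed
  then have ev: "eventually (\<lambda>n. S (\<lambda>i j. (2 / (\<nu> n i + \<nu> n j)) ^ n) \<in> nonneg_cone) sequentially"
  proof (rule eventually_mono)
    show "S (\<lambda>i j. (2 / (\<nu> n i + \<nu> n j)) ^ n) \<in> nonneg_cone" if "\<forall>c\<in>C. 0 < \<nu> n c" for n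
      using pow[of "\<nu> n" n] that by simp
  qed
  have "(\<lambda>n. (2 / (\<nu> n i + \<nu> n j)) ^ n) \<longlonglongrightarrow> 1 / (l i * l j)" if ij: "i \<in> C" "j \<in> C" for i j
  proof -
    have eq: "inverse ((1 + (ln (l i) + ln (l j)) / real n) ^ n) = (2 / (\<nu> n i + \<nu> n j)) ^ n" for n
    proof -
      have "\<nu> n i + \<nu> n j = 2 * (1 + (ln (l i) + ln (l j)) / real n)"
        by (simp add: \<nu>_def add_divide_distrib)
      moreover have "2 / (2 * t) = inverse t" for t :: real by (simp add: inverse_eq_divide)
      ultimately show ?thesis by (simp only: power_inverse)
    qed
    have "(\<lambda>n. inverse ((1 + (ln (l i) + ln (l j)) / real n) ^ n)) \<longlonglongrightarrow> inverse (exp (ln (l i) + ln (l j)))"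
      by (intro tendsto_inverse tendsto_exp_limit_sequentially) simp
    moreover have "inverse (exp (ln (l i) + ln (l j))) = 1 / (l i * l j)"
      using l ij by (simp add: exp_add inverse_eq_divide)
    ultimately show ?thesis by (simp only: eq)
  qed
  then have "(\<lambda>n. S (\<lambda>i j. (2 / (\<nu> n i + \<nu> n j)) ^ n)) \<longlonglongrightarrow> S (\<lambda>i j. 1 / (l i * l j))"
    unfolding S_def by (intro tendsto_sum tendsto_scaleR tendsto_const)
  from nonneg_cone_limit[OF ev this] have nonneg: "S (\<lambda>i j. 1 / (l i * l j)) \<in> nonneg_cone" by simp
  \<comment> \<open>The limit solves the equation that defines \<open>w\<close>, since (1/a + 1/b) /
    2 = (1/(a b)) (a + b) / 2; multiplication by \<open>x\<close> is injective.\<close>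
  have "x \<odot> S (\<lambda>i j. 1 / (l i * l j)) = spectral_fun inverse x \<odot> h"
  proof -
    have "spectral_fun inverse x \<odot> h = (\<Sum>c\<in>C. inverse (l c) *\<^sub>R c) \<odot> S (\<lambda>i j. 1)"
      by (simp add: xC spectral_fun_eq[OF C] S_def flip: hH)
    also have "\<dots> = x \<odot> S (\<lambda>i j. 1 / (l i * l j))"
      unfolding xC mult_S
    proof (rule S_cong)
      fix i j assume "i \<in> C" "j \<in> C"
      then have "l i > 0" "l j > 0" using l by auto
      then show "1 * ((inverse (l i) + inverse (l j)) / 2) = 1 / (l i * l j) * ((l i + l j) / 2)"
        by (simp add: field_simps)
    qed
    finally show ?thesis by simp
  qed
  then have "S (\<lambda>i j. 1 / (l i * l j)) = w"
    by (rule symmetric_cone_jmult_inject[OF x, of _ w, unfolded w])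
  with nonneg show ?thesis by simp
qed

section \<open>Inversion is antitone\<close>

lemma spectral_inverse_mult:
  assumes "x \<in> symmetric_cone"
  shows "x \<odot> spectral_fun inverse x = e"
proof -
  obtain C l where C: "complete_system C" and x: "x = (\<Sum>c\<in>C. l c *\<^sub>R c)"
    using spectral_decomposition .
  have l: "l c \<noteq> 0" if "c \<in> C" for c
    using that symmetric_cone_spectral[OF C, of l] assms x by fastforce
  have m: "x \<odot> c = l c *\<^sub>R c" if "c \<in> C" for c
    using complete_system_mult[OF C that, of l] by (simp only: x)
  have "x \<odot> spectral_fun inverse x = x \<odot> (\<Sum>c\<in>C. inverse (l c) *\<^sub>R c)"
    by (simp only: x spectral_fun_eq[OF C])
  also have "\<dots> = (\<Sum>c\<in>C. inverse (l c) *\<^sub>R (x \<odot> c))"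
    by (simp only: jmult_sum_right jmult_scale_right)
  also have "\<dots> = (\<Sum>c\<in>C. c)"
    using m l by (intro sum.cong) simp_all
  finally show ?thesis using C by (simp add: complete_system_def)
qed

lemma complete_system_norm_le:
  assumes C: "complete_system C" and l: "\<And>c. c \<in> C \<Longrightarrow> \<bar>l c\<bar> \<le> \<delta>" and "0 \<le> \<delta>"
  shows "norm (\<Sum>c\<in>C. l c *\<^sub>R c) \<le> \<delta> * norm e"
proof -
  have fin: "finite C" and sum: "(\<Sum>c\<in>C. c) = e" using C by (auto simp: complete_system_def)
  have pyth: "(norm (\<Sum>c\<in>C. m c *\<^sub>R c))\<^sup>2 = (\<Sum>c\<in>C. (m c)\<^sup>2 * (norm c)\<^sup>2)" for m
  proof -
    have "pairwise (\<lambda>c d. orthogonal (m c *\<^sub>R c) (m d *\<^sub>R d)) C"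
      using complete_system_pairwise_orthogonal[OF C] by (auto simp: pairwise_def orthogonal_def)
    from norm_sum_Pythagorean[OF fin this] show ?thesis by (simp add: power_mult_distrib)
  qed
  have "(norm (\<Sum>c\<in>C. l c *\<^sub>R c))\<^sup>2 \<le> (\<Sum>c\<in>C. \<delta>\<^sup>2 * (norm c)\<^sup>2)"
    unfolding pyth
  proof (rule sum_mono)
    fix c assume "c \<in> C"
    then have "(l c)\<^sup>2 \<le> \<delta>\<^sup>2" using l[of c] assms(3) abs_le_square_iff[of "l c" \<delta>] by simp
    then show "(l c)\<^sup>2 * (norm c)\<^sup>2 \<le> \<delta>\<^sup>2 * (norm c)\<^sup>2" by (rule mult_right_mono) simp
  qed
  also have "\<dots> = (\<delta> * norm e)\<^sup>2"
    using pyth[of "\<lambda>_. 1"] by (simp add: sum power_mult_distrib sum_distrib_left)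
  finally show ?thesis by (rule power2_le_imp_le) (use assms(3) in simp)
qed

lemma spectral_inverse_norm_le:
  assumes "\<epsilon> > 0" "x - \<epsilon> *\<^sub>R e \<in> nonneg_cone"
  shows "norm (spectral_fun inverse x) \<le> inverse \<epsilon> * norm e"
proof -
  obtain C l where C: "complete_system C" and x: "x = (\<Sum>c\<in>C. l c *\<^sub>R c)"
    using spectral_decomposition .
  have "(\<Sum>c\<in>C. (l c - \<epsilon>) *\<^sub>R c) \<in> nonneg_cone"
    using complete_system_shift[OF C, of l "- \<epsilon>"] assms x by simp
  then have l: "\<epsilon> \<le> l c" if "c \<in> C" for c
    using that unfolding nonneg_cone_spectral[OF C] by simp
  have "norm (\<Sum>c\<in>C. inverse (l c) *\<^sub>R c) \<le> inverse \<epsilon> * norm e"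
  proof (rule complete_system_norm_le[OF C])
    fix c assume "c \<in> C"
    then show "\<bar>inverse (l c)\<bar> \<le> inverse \<epsilon>"
      using l[of c] assms(1) le_imp_inverse_le[of \<epsilon> "l c"] by simp
  qed (use assms in simp)
  then show ?thesis by (simp only: x spectral_fun_eq[OF C])
qed

text \<open>Along the segment from \<open>x\<close> to \<open>x + h\<close> the inverse has
  derivative \<open>- w\<close> with \<open>w\<close> in the cone. Pairing with an idempotent makes
  the mean value theorem for real functions applicable.\<close>

lemma spectral_inverse_antimono:
  assumes x: "x \<in> symmetric_cone" and h: "h \<in> nonneg_cone"
  shows "spectral_fun inverse x - spectral_fun inverse (x + h) \<in> nonneg_cone"
  unfolding nonneg_cone_iff
proof safe
  fix c assume c: "idempotent c"
  obtain \<epsilon> where \<epsilon>: "\<epsilon> > 0" "x - \<epsilon> *\<^sub>R e \<in> nonneg_cone" using x symmetric_cone_iff by blast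
  define y where "y s = x + s *\<^sub>R h" for s
  define u where "u s = spectral_fun inverse (y s)" for s
  have y: "y s \<in> symmetric_cone" if "0 \<le> s" for s
    unfolding y_def using symmetric_cone_add[OF x] nonneg_cone_scale[OF h that] by blast
  have yu: "y s \<odot> u s = e" if "0 \<le> s" for s
    unfolding u_def using spectral_inverse_mult[OF y[OF that]] .
  have bound: "norm (u s) \<le> inverse \<epsilon> * norm e" if "0 \<le> s" for s
  proof -
    have "y s - \<epsilon> *\<^sub>R e \<in> nonneg_cone"
      using nonneg_cone_add[OF \<epsilon>(2) nonneg_cone_scale[OF h that]] by (simp add: y_def algebra_simps)
    then show ?thesis unfolding u_def using spectral_inverse_norm_le \<epsilon> by blast
  qed
  have deriv: "\<exists>w\<in>nonneg_cone. ((\<lambda>s. u s \<bullet> c) has_real_derivative - (w \<bullet> c)) (at s within {0..1})"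
    if s: "s \<in> {0..1}" for s
  proof -
    have s0: "0 \<le> s" using s by simp
    have "inj ((\<odot>) (y s))" using symmetric_cone_jmult_inject[OF y[OF s0]] by (auto intro: injI)
    then obtain T where T: "linear T" "\<And>z. T (y s \<odot> z) = z" "\<And>z. y s \<odot> T z = z"
      using linear_injective_isomorphism[OF linear_jmult] by blast
    have bl: "bounded_linear T" using T linear_conv_bounded_linear by blast
    interpret T: bounded_linear T by fact
    \<comment> \<open>An exact difference formula, obtained by subtracting
      \<open>y s \<odot> u s = e\<close> from its analogue at \<open>s'\<close>. With the uniform
      bound on \<open>u\<close> it yields continuity first and then the derivative.\<close>
    have diff: "u s' - u s = (s - s') *\<^sub>R T (h \<odot> u s')" if "0 \<le> s'" for s'
    proof -
      have "y s \<odot> (u s' - u s) = (s - s') *\<^sub>R (h \<odot> u s')"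
        using yu[OF that] yu[OF s0] by (simp add: y_def jmult_simps algebra_simps)
      then have "T (y s \<odot> (u s' - u s)) = T ((s - s') *\<^sub>R (h \<odot> u s'))" by simp
      then show ?thesis by (simp add: T(2) T.scaleR)
    qed
    obtain K where K: "K > 0" "\<And>z. norm (T z) \<le> norm z * K" using T.pos_bounded by blast
    obtain B where B: "B > 0" "\<And>u v. norm (u \<odot> v) \<le> B * norm u * norm v"
      using bilinear_bounded_pos[OF bilinear_jmult] by blast
    define M where "M = B * norm h * (inverse \<epsilon> * norm e) * K"
    have "norm (u s' - u s) \<le> \<bar>s' - s\<bar> * M" if "0 \<le> s'" for s'
    proof -
      have "norm (h \<odot> u s') \<le> B * norm h * (inverse \<epsilon> * norm e)"
        by (rule order_trans[OF B(2) mult_left_mono[OF bound[OF that]]]) (use B(1) in simp)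
      then have "norm (T (h \<odot> u s')) \<le> M"
        unfolding M_def using K(2)[of "h \<odot> u s'"] mult_right_mono K(1) by (meson less_imp_le order_trans)
      then show ?thesis
        unfolding diff[OF that] by (simp add: abs_minus_commute mult_left_mono)
    qed
    then have "eventually (\<lambda>s'. norm (u s' - u s) \<le> \<bar>s' - s\<bar> * M) (at s within {0..1})"
      by (auto simp: eventually_at_filter)
    moreover have "((\<lambda>s'. \<bar>s' - s\<bar> * M) \<longlongrightarrow> \<bar>s - s\<bar> * M) (at s within {0..1})"
      by (intro tendsto_intros)
    ultimately have "((\<lambda>s'. u s' - u s) \<longlongrightarrow> 0) (at s within {0..1})"
      using Lim_null_comparison by fastforce
    then have u: "(u \<longlongrightarrow> u s) (at s within {0..1})" by (rule Lim_null[THEN iffD2])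
    have lim: "((\<lambda>s'. - (T (h \<odot> u s') \<bullet> c)) \<longlongrightarrow> - (T (h \<odot> u s) \<bullet> c)) (at s within {0..1})"
      by (intro tendsto_intros T.tendsto bounded_bilinear.tendsto[OF bounded_bilinear_jmult] u)
    have "((\<lambda>s. u s \<bullet> c) has_real_derivative - (T (h \<odot> u s) \<bullet> c)) (at s within {0..1})"
      unfolding has_field_derivative_iff
    proof (rule Lim_transform_eventually[OF lim])
      have "- (T (h \<odot> u s') \<bullet> c) = (u s' \<bullet> c - u s \<bullet> c) / (s' - s)" if "0 \<le> s'" "s' \<noteq> s" for s'
        using that by (simp add: diff flip: inner_diff_left) (simp add: field_simps)
      then show "\<forall>\<^sub>F s' in at s within {0..1}. - (T (h \<odot> u s') \<bullet> c) = (u s' \<bullet> c - u s \<bullet> c) / (s' - s)"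
        by (auto simp: eventually_at_filter)
    qed
    \<comment> \<open>\<open>T\<close> inverts multiplication by \<open>y s\<close>, so this vector
      solves the equation required by \<open>symmetric_cone_quadratic_cancel\<close>.\<close>
    moreover have "T (h \<odot> u s) \<in> nonneg_cone"
      using symmetric_cone_quadratic_cancel[OF y[OF s0] h, of "T (h \<odot> u s)"]
        T(3)[of "h \<odot> u s"] jmult_commute[of h "u s"] by (simp add: u_def)
    ultimately show ?thesis by blast
  qed
  then have "\<forall>s\<in>{0..1}. \<exists>w. w \<in> nonneg_cone \<and>
      ((\<lambda>s. u s \<bullet> c) has_derivative (*) (- (w \<bullet> c))) (at s within {0..1})"
    unfolding has_field_derivative_def by blast
  then obtain w where w: "\<forall>s\<in>{0..1}. w s \<in> nonneg_cone \<and>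
      ((\<lambda>s. u s \<bullet> c) has_derivative (*) (- (w s \<bullet> c))) (at s within {0..1})"
    by (rule bchoice[THEN exE])
  have "\<exists>s\<in>{0<..<1}. u 1 \<bullet> c - u 0 \<bullet> c = - (w s \<bullet> c) * (1 - 0)"
  proof (rule mvt_simple)
    fix s :: real assume "0 \<le> s" "s \<le> 1"
    then have "s \<in> {0..1}" by simp
    then show "((\<lambda>s. u s \<bullet> c) has_derivative (*) (- (w s \<bullet> c))) (at s within {0..1})"
      using w by blast
  qed simp
  then obtain s where s: "s \<in> {0<..<1}" "u 1 \<bullet> c - u 0 \<bullet> c = - (w s \<bullet> c) * (1 - 0)" by blast
  have "0 \<le> w s \<bullet> c" using w s(1) c nonneg_cone_iff[of "w s"] by simp
  with s(2) show "0 \<le> (spectral_fun inverse x - spectral_fun inverse (x + h)) \<bullet> c"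
    by (simp add: u_def y_def inner_simps)
qed

section \<open>The Loewner--Heinz inequality\<close>

lemma symmetric_cone_decomposition:
  assumes "x \<in> symmetric_cone"
  obtains C l where "complete_system C" "x = (\<Sum>c\<in>C. l c *\<^sub>R c)" "\<forall>c\<in>C. 0 < l c"
proof -
  obtain C l where C: "complete_system C" and x: "x = (\<Sum>c\<in>C. l c *\<^sub>R c)"
    using spectral_decomposition .
  moreover have "\<forall>c\<in>C. 0 < l c" using assms symmetric_cone_spectral[OF C, of l] x by simp
  ultimately show ?thesis by (rule that)
qed

lemma spectral_fun_pos:
  assumes "x \<in> symmetric_cone" "\<And>s. 0 < s \<Longrightarrow> 0 < f s"
  shows "spectral_fun f x \<in> symmetric_cone"
proof -
  obtain C l where C: "complete_system C" and x: "x = (\<Sum>c\<in>C. l c *\<^sub>R c)" and l: "\<forall>c\<in>C. 0 < l c"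
    using symmetric_cone_decomposition[OF assms(1)] .
  show ?thesis unfolding x spectral_fun_eq[OF C] using symmetric_cone_spectral[OF C, of "\<lambda>c. f (l c)"] l assms(2) by simp
qed

lemma spectral_fun_cong:
  assumes "x \<in> symmetric_cone" "\<And>s. 0 < s \<Longrightarrow> f s = h s"
  shows "spectral_fun f x = spectral_fun h x"
proof -
  obtain C l where C: "complete_system C" and x: "x = (\<Sum>c\<in>C. l c *\<^sub>R c)" and l: "\<forall>c\<in>C. 0 < l c"
    using symmetric_cone_decomposition[OF assms(1)] .
  show ?thesis unfolding x spectral_fun_eq[OF C] using l assms(2) by (intro sum.cong) simp_all
qed

lemma spectral_fun_comp: "spectral_fun f (spectral_fun h x) = spectral_fun (\<lambda>s. f (h s)) x"
proof -
  obtain C l where C: "complete_system C" and x: "x = (\<Sum>c\<in>C. l c *\<^sub>R c)"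
    using spectral_decomposition .
  show ?thesis
    unfolding x spectral_fun_eq[OF C] spectral_fun_eq[OF C, of f "\<lambda>c. h (l c)"] ..
qed

lemma spectral_fun_ident: "spectral_fun (\<lambda>s. s) x = x"
proof -
  obtain C l where C: "complete_system C" and x: "x = (\<Sum>c\<in>C. l c *\<^sub>R c)"
    using spectral_decomposition .
  show ?thesis unfolding x spectral_fun_eq[OF C] ..
qed

lemma spectral_fun_scale_left: "spectral_fun (\<lambda>s. k * f s) x = k *\<^sub>R spectral_fun f x"
proof -
  obtain C l where C: "complete_system C" and x: "x = (\<Sum>c\<in>C. l c *\<^sub>R c)"
    using spectral_decomposition .
  show ?thesis unfolding x spectral_fun_eq[OF C] by (simp add: scaleR_sum_right)
qed

lemma spectral_fun_scale: "spectral_fun f (k *\<^sub>R x) = spectral_fun (\<lambda>s. f (k * s)) x"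
  using spectral_fun_comp[of f "\<lambda>s. k * s" x]
  by (simp add: spectral_fun_scale_left spectral_fun_ident)

lemma symmetric_cone_scale:
  assumes "x \<in> symmetric_cone" "0 < k"
  shows "k *\<^sub>R x \<in> symmetric_cone"
proof -
  have "spectral_fun (\<lambda>s. k * s) x \<in> symmetric_cone" using assms by (intro spectral_fun_pos) simp_all
  then show ?thesis by (simp add: spectral_fun_scale_left spectral_fun_ident)
qed

lemma spectral_inverse_antimono':
  assumes "x \<in> symmetric_cone" "y - x \<in> nonneg_cone"
  shows "spectral_fun inverse x - spectral_fun inverse y \<in> nonneg_cone"
  using spectral_inverse_antimono[OF assms] by simp

text \<open>The power \<open>x\<^sup>t\<close> is an integral, against a positive weight, of the functions
  \<open>x (x + s)\<^sup>-\<^sup>1 = e - s (x + s)\<^sup>-\<^sup>1\<close> with \<open>s = exp v\<close>; these are monotone because inversion is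
  antitone.\<close>

lemma spectral_powr_mono:
  assumes x: "x \<in> symmetric_cone" and xy: "y - x \<in> nonneg_cone" and t: "0 < t" "t < 1"
  shows "spectral_fun (\<lambda>s. s powr t) y - spectral_fun (\<lambda>s. s powr t) x \<in> nonneg_cone"
  unfolding nonneg_cone_iff
proof safe
  fix d assume d: "idempotent d"
  obtain K where "0 < K" and K: "\<forall>s>0. has_bochner_integral lborel
      (\<lambda>v. exp (t * v) * (1 - exp v * inverse (s + exp v))) (s powr t * K)"
    using powr_integral_representation[OF t] .
  \<comment> \<open>The integrand paired with \<open>d\<close>, so that the integral is real-valued;
    positivity of \<open>K\<close> allows it to be cancelled at the end.\<close>
  define R where "R z v = exp (t * v) * ((e - exp v *\<^sub>R spectral_fun inverse (z + exp v *\<^sub>R e)) \<bullet> d)" for z v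
  have R: "has_bochner_integral lborel (R z) (K * (spectral_fun (\<lambda>s. s powr t) z \<bullet> d))"
    if z: "z \<in> symmetric_cone" for z
  proof -
    obtain C l where C: "complete_system C" and zC: "z = (\<Sum>c\<in>C. l c *\<^sub>R c)" and l: "\<forall>c\<in>C. 0 < l c"
      using symmetric_cone_decomposition[OF z] .
    have sum: "(\<Sum>c\<in>C. c) = e" using C by (simp add: complete_system_def)
    have inv: "spectral_fun inverse (z + exp v *\<^sub>R e) = (\<Sum>c\<in>C. inverse (l c + exp v) *\<^sub>R c)" for v
      unfolding zC complete_system_shift[OF C] spectral_fun_eq[OF C] ..
    have "has_bochner_integral lborel
        (\<lambda>v. \<Sum>c\<in>C. (exp (t * v) * (1 - exp v * inverse (l c + exp v))) * (c \<bullet> d))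
        (\<Sum>c\<in>C. (l c powr t * K) * (c \<bullet> d))"
      using K l by (intro has_bochner_integral_sum has_bochner_integral_mult_left) simp
    moreover have "(\<Sum>c\<in>C. (exp (t * v) * (1 - exp v * inverse (l c + exp v))) * (c \<bullet> d)) = R z v" for v
      unfolding R_def inv unfolding sum[symmetric]
      by (simp add: inner_diff_left inner_sum_left sum_distrib_left algebra_simps flip: sum_subtractf)
    moreover have "(\<Sum>c\<in>C. (l c powr t * K) * (c \<bullet> d)) = K * (spectral_fun (\<lambda>s. s powr t) z \<bullet> d)"
      unfolding zC spectral_fun_eq[OF C] by (simp add: inner_sum_left sum_distrib_left mult_ac)
    ultimately show ?thesis by simp
  qed
  have y: "y \<in> symmetric_cone" using symmetric_cone_add[OF x xy] by simp
  have "R x v \<le> R y v" for v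
  proof -
    have "exp v *\<^sub>R e \<in> nonneg_cone"
      using nonneg_cone_scale[of e "exp v"] d idempotent_identity
      by (simp add: nonneg_cone_iff[of e] idempotents_inner_nonneg)
    then have "x + exp v *\<^sub>R e \<in> symmetric_cone" by (rule symmetric_cone_add[OF x])
    then have "spectral_fun inverse (x + exp v *\<^sub>R e) - spectral_fun inverse (y + exp v *\<^sub>R e) \<in> nonneg_cone"
      by (rule spectral_inverse_antimono') (use xy in simp)
    then have "0 \<le> (spectral_fun inverse (x + exp v *\<^sub>R e) - spectral_fun inverse (y + exp v *\<^sub>R e)) \<bullet> d"
      using d nonneg_cone_iff by blast
    then show ?thesis
      unfolding R_def by (intro mult_left_mono) (simp_all add: inner_diff_left)
  qed
  then have "K * (spectral_fun (\<lambda>s. s powr t) x \<bullet> d) \<le> K * (spectral_fun (\<lambda>s. s powr t) y \<bullet> d)"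
    using R[OF x] R[OF y] integral_mono[of lborel "R x" "R y"] by (simp add: has_bochner_integral_iff)
  then show "0 \<le> (spectral_fun (\<lambda>s. s powr t) y - spectral_fun (\<lambda>s. s powr t) x) \<bullet> d"
    using \<open>0 < K\<close> by (simp add: inner_diff_left)
qed

section \<open>The Thompson metric\<close>

text \<open>The Thompson distance of \<open>x\<close> and \<open>y\<close> is the least \<open>r \<ge> 0\<close> with \<open>thompson r x y\<close>.\<close>

definition thompson :: "real \<Rightarrow> 'a \<Rightarrow> 'a \<Rightarrow> bool"
  where "thompson r x y \<longleftrightarrow> exp r *\<^sub>R y - x \<in> nonneg_cone \<and> exp r *\<^sub>R x - y \<in> nonneg_cone"

lemma thompson_sym: "thompson r x y \<Longrightarrow> thompson r y x"
  by (simp add: thompson_def)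

lemma thompson_mono:
  assumes "thompson r x y" "r \<le> s" "x \<in> symmetric_cone" "y \<in> symmetric_cone"
  shows "thompson s x y"
proof -
  have "exp s *\<^sub>R v - w \<in> nonneg_cone" if "exp r *\<^sub>R v - w \<in> nonneg_cone" "v \<in> symmetric_cone" for v w
  proof -
    have "v \<in> nonneg_cone" using that symmetric_cone_subset by blast
    then have "(exp s - exp r) *\<^sub>R v \<in> nonneg_cone" using assms(2) by (intro nonneg_cone_scale) simp_all
    from nonneg_cone_add[OF that(1) this] show ?thesis by (simp add: algebra_simps)
  qed
  then show ?thesis using assms by (simp add: thompson_def)
qed

lemma thompson_trans:
  assumes "thompson r x y" "thompson s y z"
  shows "thompson (r + s) x z"
proof -
  have "exp (r + s) *\<^sub>R w - u \<in> nonneg_cone"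
    if "exp a *\<^sub>R v - u \<in> nonneg_cone" "exp b *\<^sub>R w - v \<in> nonneg_cone" "a + b = r + s" for a b u v w
  proof -
    have "exp a *\<^sub>R (exp b *\<^sub>R w - v) + (exp a *\<^sub>R v - u) \<in> nonneg_cone"
      using that by (intro nonneg_cone_add nonneg_cone_scale) simp_all
    then show ?thesis by (simp add: scaleR_diff_right that(3) flip: exp_add)
  qed
  from this[of r y x s z] this[of s y z r x] show ?thesis
    using assms by (simp add: thompson_def)
qed

lemma symmetric_cone_absorbs:
  assumes "y \<in> symmetric_cone"
  obtains M where "0 < M" "M *\<^sub>R y - x \<in> nonneg_cone"
proof -
  obtain \<epsilon> where \<epsilon>: "\<epsilon> > 0" "y - \<epsilon> *\<^sub>R e \<in> nonneg_cone" using assms symmetric_cone_iff by blast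
  obtain C l where C: "complete_system C" and x: "x = (\<Sum>c\<in>C. l c *\<^sub>R c)"
    using spectral_decomposition .
  \<comment> \<open>The sum dominates every eigenvalue of \<open>x\<close>; the 1 keeps
    \<open>L\<close> positive when all of them vanish.\<close>
  define L where "L = 1 + (\<Sum>c\<in>C. \<bar>l c\<bar>)"
  have L: "0 < L" by (simp add: L_def add_pos_nonneg sum_nonneg)
  have lL: "l c \<le> L" if "c \<in> C" for c
    using member_le_sum[of c C "\<lambda>c. \<bar>l c\<bar>"] that C by (simp add: L_def complete_system_def)
  have "L *\<^sub>R e - x = (\<Sum>c\<in>C. (- l c + L) *\<^sub>R c)"
    using complete_system_shift[OF C, of "\<lambda>c. - l c" L] by (simp add: x sum_negf)
  then have "L *\<^sub>R e - x \<in> nonneg_cone" using nonneg_cone_spectral[OF C, of "\<lambda>c. - l c + L"] lL by simp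
  moreover have "(L / \<epsilon>) *\<^sub>R (y - \<epsilon> *\<^sub>R e) \<in> nonneg_cone" using \<epsilon> L by (intro nonneg_cone_scale) simp_all
  ultimately have "(L / \<epsilon>) *\<^sub>R (y - \<epsilon> *\<^sub>R e) + (L *\<^sub>R e - x) \<in> nonneg_cone"
    by (intro nonneg_cone_add)
  then have "(L / \<epsilon>) *\<^sub>R y - x \<in> nonneg_cone" using \<epsilon>(1) by (simp add: scaleR_diff_right)
  moreover have "0 < L / \<epsilon>" using L \<epsilon>(1) by simp
  ultimately show ?thesis by (intro that)
qed

lemma thompson_exists:
  assumes x: "x \<in> symmetric_cone" and y: "y \<in> symmetric_cone"
  obtains r where "0 \<le> r" "thompson r x y"
proof -
  obtain M where M: "0 < M" "M *\<^sub>R y - x \<in> nonneg_cone" using symmetric_cone_absorbs[OF y] .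
  obtain N where N: "0 < N" "N *\<^sub>R x - y \<in> nonneg_cone" using symmetric_cone_absorbs[OF x] .
  define r where "r = max 0 (max (ln M) (ln N))"
  have bound: "exp r *\<^sub>R v - w \<in> nonneg_cone"
    if "0 < k" "k *\<^sub>R v - w \<in> nonneg_cone" "ln k \<le> r" "v \<in> symmetric_cone" for k v w
  proof -
    have "k \<le> exp r" using that(1,3) exp_ln[of k] exp_le_cancel_iff[of "ln k" r] by simp
    moreover have "v \<in> nonneg_cone" using that symmetric_cone_subset by blast
    ultimately have "(exp r - k) *\<^sub>R v \<in> nonneg_cone" by (intro nonneg_cone_scale) simp_all
    from nonneg_cone_add[OF that(2) this] show ?thesis by (simp add: algebra_simps)
  qed
  have "thompson r x y"
    unfolding thompson_def using bound[OF M _ y] bound[OF N _ x] by (simp add: r_def)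
  moreover have "0 \<le> r" by (simp add: r_def)
  ultimately show ?thesis by (intro that)
qed

text \<open>Inversion reverses the order and has degree -1, so each of the two order bounds for
  \<open>x\<close> and \<open>y\<close> becomes the other one for their inverses, with the same
  factor.\<close>

lemma thompson_spectral_inverse:
  assumes x: "x \<in> symmetric_cone" and y: "y \<in> symmetric_cone" and r: "thompson r x y"
  shows "thompson r (spectral_fun inverse x) (spectral_fun inverse y)"
proof -
  have "exp r *\<^sub>R spectral_fun inverse v - spectral_fun inverse w \<in> nonneg_cone"
    if "exp r *\<^sub>R w - v \<in> nonneg_cone" "v \<in> symmetric_cone" for v w
  proof -
    have "spectral_fun inverse v - spectral_fun inverse (exp r *\<^sub>R w) \<in> nonneg_cone"
      using spectral_inverse_antimono'[OF that(2,1)] .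
    also have "spectral_fun inverse (exp r *\<^sub>R w) = exp (- r) *\<^sub>R spectral_fun inverse w"
      by (simp add: spectral_fun_scale spectral_fun_scale_left exp_minus)
    finally have "exp r *\<^sub>R (spectral_fun inverse v - exp (- r) *\<^sub>R spectral_fun inverse w) \<in> nonneg_cone"
      by (intro nonneg_cone_scale) simp_all
    then show ?thesis by (simp add: scaleR_diff_right flip: exp_add)
  qed
  then show ?thesis using assms by (simp add: thompson_def)
qed

text \<open>For positive exponents: monotonicity together with homogeneity of degree
  \<open>q\<close>. A negative power is the power with exponent \<open>\<bar>q\<bar>\<close> of the
  inverse, and inversion does not change the distance.\<close>

lemma thompson_spectral_powr:
  assumes x: "x \<in> symmetric_cone" and y: "y \<in> symmetric_cone" and r: "thompson r x y"
    and q: "q \<noteq> 0" "\<bar>q\<bar> < 1"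
  shows "thompson (\<bar>q\<bar> * r) (spectral_fun (\<lambda>s. s powr q) x) (spectral_fun (\<lambda>s. s powr q) y)"
proof -
  have pos: "thompson (t * r) (spectral_fun (\<lambda>s. s powr t) v) (spectral_fun (\<lambda>s. s powr t) w)"
    if v: "v \<in> symmetric_cone" and w: "w \<in> symmetric_cone" and vw: "thompson r v w"
      and t: "0 < t" "t < 1" for t v w
  proof -
    have "exp (t * r) *\<^sub>R spectral_fun (\<lambda>s. s powr t) b - spectral_fun (\<lambda>s. s powr t) a \<in> nonneg_cone"
      if "exp r *\<^sub>R b - a \<in> nonneg_cone" "a \<in> symmetric_cone" "b \<in> symmetric_cone" for a b
    proof -
      have "spectral_fun (\<lambda>s. s powr t) (exp r *\<^sub>R b) - spectral_fun (\<lambda>s. s powr t) a \<in> nonneg_cone"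
        using spectral_powr_mono[OF that(2,1) t] .
      also have "spectral_fun (\<lambda>s. s powr t) (exp r *\<^sub>R b) = spectral_fun (\<lambda>s. exp (t * r) * s powr t) b"
        unfolding spectral_fun_scale using that(3)
        by (rule spectral_fun_cong) (simp add: powr_mult exp_powr_real mult.commute)
      finally show ?thesis by (simp add: spectral_fun_scale_left)
    qed
    then show ?thesis using v w vw by (simp add: thompson_def)
  qed
  show ?thesis
  proof (cases "0 < q")
    case True
    then show ?thesis using pos[OF x y r] q by simp
  next
    case False
    have eq: "spectral_fun (\<lambda>s. s powr q) v = spectral_fun (\<lambda>s. s powr \<bar>q\<bar>) (spectral_fun inverse v)"
      if "v \<in> symmetric_cone" for v
      unfolding spectral_fun_comp using that
      by (rule spectral_fun_cong) (use False in \<open>simp add: powr_minus flip: inverse_powr\<close>)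
    have inv: "spectral_fun inverse v \<in> symmetric_cone" if "v \<in> symmetric_cone" for v
      using that by (rule spectral_fun_pos) simp
    show ?thesis unfolding eq[OF x] eq[OF y]
      using pos[OF inv[OF x] inv[OF y] thompson_spectral_inverse[OF x y r]] q by simp
  qed
qed

lemma norm_le_of_order_bounds:
  assumes "\<delta> *\<^sub>R e - w \<in> nonneg_cone" "\<delta> *\<^sub>R e + w \<in> nonneg_cone" "0 \<le> \<delta>"
  shows "norm w \<le> \<delta> * norm e"
proof -
  obtain C l where C: "complete_system C" and w: "w = (\<Sum>c\<in>C. l c *\<^sub>R c)"
    using spectral_decomposition .
  have "(\<Sum>c\<in>C. (- l c + \<delta>) *\<^sub>R c) \<in> nonneg_cone" "(\<Sum>c\<in>C. (l c + \<delta>) *\<^sub>R c) \<in> nonneg_cone"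
    using assms(1,2) complete_system_shift[OF C, of "\<lambda>c. - l c" \<delta>] complete_system_shift[OF C, of l \<delta>]
    by (simp_all add: w sum_negf add.commute)
  then have "\<forall>c\<in>C. 0 \<le> - l c + \<delta>" "\<forall>c\<in>C. 0 \<le> l c + \<delta>"
    unfolding nonneg_cone_spectral[OF C] .
  then have "\<bar>l c\<bar> \<le> \<delta>" if "c \<in> C" for c using that by force
  then show ?thesis unfolding w by (rule complete_system_norm_le[OF C]) (use assms in simp_all)
qed

text \<open>In the cone order, x - y \<le> (exp r - 1) y \<le> (exp r - 1) R e, and likewise with
  \<open>x\<close> and \<open>y\<close> exchanged. This makes completeness of the norm available for
  the iteration.\<close>

lemma thompson_norm_diff_le:
  assumes r: "thompson r x y" "0 \<le> r" and R: "R *\<^sub>R e - x \<in> nonneg_cone" "R *\<^sub>R e - y \<in> nonneg_cone" "0 \<le> R"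
  shows "norm (x - y) \<le> (exp r - 1) * R * norm e"
proof (rule norm_le_of_order_bounds)
  have "(exp r - 1) *\<^sub>R (R *\<^sub>R e - v) + (exp r *\<^sub>R v - w) \<in> nonneg_cone"
    if "exp r *\<^sub>R v - w \<in> nonneg_cone" "R *\<^sub>R e - v \<in> nonneg_cone" for v w
    using that r(2) by (intro nonneg_cone_add nonneg_cone_scale) simp_all
  from this[of y x] this[of x y]
  show "((exp r - 1) * R) *\<^sub>R e - (x - y) \<in> nonneg_cone" "((exp r - 1) * R) *\<^sub>R e + (x - y) \<in> nonneg_cone"
    using r R by (simp_all add: thompson_def algebra_simps)
  show "0 \<le> (exp r - 1) * R" using r R by simp
qed

text \<open>The separation axiom of the metric, in the form met by geometric iteration: in the limit
  both \<open>y - x\<close> and \<open>x - y\<close> lie in the closed cone.\<close>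

lemma thompson_limit_eq:
  assumes "\<And>n. thompson (R * t ^ n) x y" "0 \<le> t" "t < 1"
  shows "x = y"
proof -
  have lim: "(\<lambda>n. exp (R * t ^ n) *\<^sub>R v - w) \<longlonglongrightarrow> exp (R * 0) *\<^sub>R v - w" for v w :: 'a
    using assms by (intro tendsto_intros LIMSEQ_power_zero) simp
  have "exp (R * 0) *\<^sub>R y - x \<in> nonneg_cone" "exp (R * 0) *\<^sub>R x - y \<in> nonneg_cone"
    by (rule nonneg_cone_limit[OF _ lim]; use assms(1) in \<open>simp add: thompson_def\<close>)+
  then show ?thesis using nonneg_cone_antisym[of "x - y"] by simp
qed

section \<open>Fixed points of contractions for the Thompson metric\<close>

lemma identity_in_symmetric_cone: "e \<in> symmetric_cone"
  unfolding symmetric_cone_iff using zero_in_nonneg_cone by (intro exI[of _ 1]) simp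

lemma thompson_contraction_fixed_point:
  assumes F: "\<And>x. x \<in> symmetric_cone \<Longrightarrow> F x \<in> symmetric_cone"
    and contr: "\<And>x y r. x \<in> symmetric_cone \<Longrightarrow> y \<in> symmetric_cone \<Longrightarrow> thompson r x y \<Longrightarrow>
      thompson (t * r) (F x) (F y)"
    and t: "0 \<le> t" "t < 1"
  shows "\<exists>!x. x \<in> symmetric_cone \<and> F x = x"
proof (rule ex_ex1I)
  define a where "a n = (F ^^ n) e" for n
  have a0: "a 0 = e" and aS: "\<And>n. a (Suc n) = F (a n)" by (simp_all add: a_def)
  have a: "a n \<in> symmetric_cone" for n
    by (induction n) (simp_all add: a0 aS F identity_in_symmetric_cone)
  obtain r where r: "0 \<le> r" "thompson r (a 0) (a 1)" using thompson_exists[OF a a] .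
  have step: "thompson (r * t ^ n) (a n) (a (Suc n))" for n
  proof (induction n)
    case (Suc n)
    from contr[OF a a this] show ?case by (simp add: aS mult_ac)
  qed (use r in simp)
  \<comment> \<open>The parameter is the geometric sum of the steps from \<open>m\<close> to
    \<open>m + k - 1\<close> in closed form.\<close>
  have chain: "thompson (r * (t ^ m - t ^ (m + k)) / (1 - t)) (a m) (a (m + k))" for m k
  proof (induction k)
    case 0
    then show ?case by (simp add: thompson_def zero_in_nonneg_cone)
  next
    case (Suc k)
    have "r * (t ^ m - t ^ (m + k)) / (1 - t) + r * t ^ (m + k) = r * (t ^ m - t ^ (m + Suc k)) / (1 - t)"
      using t by (simp add: field_simps)
    with thompson_trans[OF Suc step] show ?case by simp
  qed
  define R where "R = r / (1 - t)"
  have R: "0 \<le> R" using r t by (simp add: R_def)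
  have dist: "thompson (R * t ^ m) (a m) (a n)" if "m \<le> n" for m n
  proof (rule thompson_mono)
    show "thompson (r * (t ^ m - t ^ n) / (1 - t)) (a m) (a n)" using chain[of m "n - m"] that by simp
    show "r * (t ^ m - t ^ n) / (1 - t) \<le> R * t ^ m"
      using r t by (simp add: R_def divide_right_mono mult_left_mono)
  qed (rule a)+
  have upper: "exp R *\<^sub>R e - a n \<in> nonneg_cone" for n
    using dist[of 0 n] by (simp add: thompson_def a0)
  define \<beta> where "\<beta> m = (exp (R * t ^ m) - 1) * exp R * norm e" for m
  have \<beta>: "norm (a m - a n) \<le> \<beta> m" if "m \<le> n" for m n
    unfolding \<beta>_def using R t by (intro thompson_norm_diff_le[OF dist[OF that]] upper) simp_all
  have "\<beta> \<longlonglongrightarrow> (exp (R * 0) - 1) * exp R * norm e"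
    unfolding \<beta>_def using t by (intro tendsto_intros LIMSEQ_power_zero) simp
  then have "\<beta> \<longlonglongrightarrow> 0" by simp
  have "Cauchy a"
  proof (rule metric_CauchyI)
    fix \<epsilon> :: real assume "0 < \<epsilon>"
    then have "eventually (\<lambda>m. \<beta> m < \<epsilon> / 2) sequentially"
      by (intro order_tendstoD(2)[OF \<open>\<beta> \<longlonglongrightarrow> 0\<close>]) simp
    then obtain M where M: "\<beta> M < \<epsilon> / 2" by (auto simp: eventually_sequentially)
    have "dist (a m) (a n) < \<epsilon>" if "M \<le> m" "M \<le> n" for m n
      using \<beta>[OF that(1)] \<beta>[OF that(2)] M dist_triangle3[of "a m" "a n" "a M"] by (simp add: dist_norm)
    then show "\<exists>M. \<forall>m\<ge>M. \<forall>n\<ge>M. dist (a m) (a n) < \<epsilon>" by blast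
  qed
  then obtain L where L: "a \<longlonglongrightarrow> L" by (auto simp: Cauchy_convergent_iff convergent_def)
  have distL: "thompson (R * t ^ m) (a m) L" for m
    unfolding thompson_def
  proof
    have lim1: "(\<lambda>n. exp (R * t ^ m) *\<^sub>R a n - a m) \<longlonglongrightarrow> exp (R * t ^ m) *\<^sub>R L - a m"
      and lim2: "(\<lambda>n. exp (R * t ^ m) *\<^sub>R a m - a n) \<longlonglongrightarrow> exp (R * t ^ m) *\<^sub>R a m - L"
      by (intro tendsto_intros L)+
    have ev: "eventually (\<lambda>n. thompson (R * t ^ m) (a m) (a n)) sequentially"
      using dist by (auto simp: eventually_sequentially)
    show "exp (R * t ^ m) *\<^sub>R L - a m \<in> nonneg_cone"
      by (rule nonneg_cone_limit[OF eventually_mono[OF ev] lim1]) (simp_all add: thompson_def)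
    show "exp (R * t ^ m) *\<^sub>R a m - L \<in> nonneg_cone"
      by (rule nonneg_cone_limit[OF eventually_mono[OF ev] lim2]) (simp_all add: thompson_def)
  qed
  have "L \<in> symmetric_cone"
  proof -
    \<comment> \<open>The bound against the starting point \<open>e\<close> keeps the limit away
      from the boundary: L \<ge> exp (-R) e.\<close>
    have "exp (- R) *\<^sub>R (exp R *\<^sub>R L - e) \<in> nonneg_cone"
      using distL[of 0] by (intro nonneg_cone_scale) (simp_all add: thompson_def a0)
    then have "L - exp (- R) *\<^sub>R e \<in> nonneg_cone" by (simp add: scaleR_diff_right flip: exp_add)
    then show ?thesis unfolding symmetric_cone_iff by (intro exI[of _ "exp (- R)"]) simp
  qed
  moreover have "F L = L"
  proof (rule thompson_limit_eq[OF _ t])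
    fix n
    \<comment> \<open>Both \<open>F L\<close> and \<open>L\<close> are within
      \<open>R * t ^ Suc n\<close> of the same iterate, whence the factor 2.\<close>
    have "thompson (R * t ^ Suc n) (F L) (a (Suc n))"
      using contr[OF a \<open>L \<in> symmetric_cone\<close> distL[of n]] by (simp add: aS mult_ac thompson_sym)
    from thompson_trans[OF this distL] show "thompson (2 * R * t * t ^ n) (F L) L"
      by (simp add: algebra_simps)
  qed
  ultimately show "\<exists>x. x \<in> symmetric_cone \<and> F x = x" by blast
next
  fix x y assume xy: "x \<in> symmetric_cone \<and> F x = x" "y \<in> symmetric_cone \<and> F y = y"
  obtain r where r: "thompson r x y" using thompson_exists xy by blast
  have "thompson (r * t ^ n) x y" for n
  proof (induction n)
    case (Suc n)
    then have "thompson (t * (r * t ^ n)) (F x) (F y)" using contr xy by blast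
    then show ?case using xy by (simp add: mult_ac)
  qed (use r in simp)
  then show "x = y" using t by (rule thompson_limit_eq)
qed

section \<open>Automorphisms of the cone and the equation for powers\<close>

lemma cone_group_nonneg_cone:
  assumes "g \<in> cone_group" "x \<in> nonneg_cone"
  shows "g x \<in> nonneg_cone"
proof (rule nonneg_cone_limit)
  have g: "linear g" "g ` symmetric_cone = symmetric_cone" using assms by (auto simp: cone_group_def)
  \<comment> \<open>Membership in the group speaks of the open cone only; \<open>x + s e\<close>
    lies in it for s > 0, and s tends to 0.\<close>
  have "g x + s *\<^sub>R g e \<in> nonneg_cone" if "0 < s" for s
  proof -
    have "s *\<^sub>R e + x \<in> symmetric_cone"
      using symmetric_cone_add[OF symmetric_cone_scale[OF identity_in_symmetric_cone that] assms(2)] .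
    then have "g (s *\<^sub>R e + x) \<in> nonneg_cone" using g(2) symmetric_cone_subset by blast
    then show ?thesis by (simp add: linear_add[OF g(1)] linear_scale[OF g(1)] add.commute)
  qed
  then show "eventually (\<lambda>s. g x + s *\<^sub>R g e \<in> nonneg_cone) (at_right 0)"
    by (auto simp: eventually_at_right_less eventually_at_filter)
  have "((\<lambda>s. g x + s *\<^sub>R g e) \<longlongrightarrow> g x + 0 *\<^sub>R g e) (at_right 0)" by (intro tendsto_intros)
  then show "((\<lambda>s. g x + s *\<^sub>R g e) \<longlongrightarrow> g x) (at_right 0)" by simp
qed simp

lemma cone_group_power_fixed_point:
  assumes g: "g \<in> cone_group" and p: "1 < \<bar>p\<bar>"
  shows "\<exists>!a. a \<in> symmetric_cone \<and> g a = jordan_power a p"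
proof -
  define F where "F a = spectral_fun (\<lambda>s. s powr (1 / p)) (g a)" for a
  have g': "linear g" "\<And>x. x \<in> symmetric_cone \<Longrightarrow> g x \<in> symmetric_cone"
    using g by (auto simp: cone_group_def)
  have "\<exists>!a. a \<in> symmetric_cone \<and> F a = a"
  proof (rule thompson_contraction_fixed_point)
    show "F x \<in> symmetric_cone" if "x \<in> symmetric_cone" for x
      unfolding F_def using g'(2)[OF that] by (rule spectral_fun_pos) simp
    show "thompson (\<bar>1 / p\<bar> * r) (F x) (F y)"
      if "x \<in> symmetric_cone" "y \<in> symmetric_cone" "thompson r x y" for x y r
      unfolding F_def
    proof (rule thompson_spectral_powr)
      show "thompson r (g x) (g y)"
        using that(3) cone_group_nonneg_cone[OF g, of "exp r *\<^sub>R y - x"]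
          cone_group_nonneg_cone[OF g, of "exp r *\<^sub>R x - y"]
        by (simp add: thompson_def linear_diff[OF g'(1)] linear_scale[OF g'(1)])
    qed (use that p g' in auto)
  qed (use p in auto)
  moreover have "F a = a \<longleftrightarrow> g a = jordan_power a p" if a: "a \<in> symmetric_cone" for a
  proof -
    \<comment> \<open>Powers with reciprocal exponents undo each other on the open cone, where all
      eigenvalues are positive; this turns the fixed-point equation into the required one.\<close>
    have comp: "spectral_fun (\<lambda>s. s powr u) (spectral_fun (\<lambda>s. s powr v) x) = x"
      if "x \<in> symmetric_cone" "v * u = 1" for x u v
    proof -
      have "spectral_fun (\<lambda>s. (s powr v) powr u) x = spectral_fun (\<lambda>s. s) x"
        using that(1) by (rule spectral_fun_cong) (simp add: powr_powr that(2))
      then show ?thesis by (simp add: spectral_fun_comp spectral_fun_ident)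
    qed
    have p': "p * (1 / p) = 1" "1 / p * p = 1" using p by auto
    show ?thesis
      unfolding jordan_power_eq_spectral_fun F_def
    proof
      assume "spectral_fun (\<lambda>s. s powr (1 / p)) (g a) = a"
      then show "g a = spectral_fun (\<lambda>s. s powr p) a" using comp[OF g'(2)[OF a] p'(2)] by simp
    next
      assume "g a = spectral_fun (\<lambda>s. s powr p) a"
      then show "spectral_fun (\<lambda>s. s powr (1 / p)) (g a) = a" using comp[OF a p'(1)] by simp
    qed
  qed
  ultimately show ?thesis by (simp cong: conj_cong)
qed

end

theorem theorem6p1:
  fixes jmult :: "'a::euclidean_space \<Rightarrow> 'a \<Rightarrow> 'a" and e :: 'a
    and g :: "'a \<Rightarrow> 'a" and p :: real
  assumes "simple_euclidean_jordan_algebra jmult e"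
    and "g \<in> euclidean_jordan_algebra.cone_group jmult"
    and "\<bar>p\<bar> > 1"
  shows "\<exists>!a. a \<in> euclidean_jordan_algebra.symmetric_cone jmult \<and>
    g a = euclidean_jordan_algebra.jordan_power jmult e a p"
proof -
  interpret simple_euclidean_jordan_algebra jmult e by fact
  show ?thesis using cone_group_power_fixed_point assms(2,3) by blast
qed

end
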